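(* Let $(M,\omega_g)$ be a compact Hermitian manifold of complex dimension $n\ge 2$ and let $p>1$ be a real number. Then $\omega_g$ is $p$-conformal extremal if and only if the equation $$\square_g^*\left(s_g|s_g|^{p-2}\right)=\frac{n-p}{np}\left(|s_g|^p-\frac{1}{\int_M \frac{\omega_g^n}{n!}}\int_M|s_g|^p\frac{\omega_g^n}{n!}\right)$$ holds in the sense of distributions on $M$.
   Context: For a Hermitian metric $\omega_g=\sqrt{-1}\,g_{i\bar j}\,dz^i\wedge d\bar z^j$ on a complex manifold $M$ of dimension $n$, the Chern scalar curvature is $s_g=g^{i\bar j}g^{k\bar\ell}\Theta_{i\bar jk\bar\ell}$, where $\Theta$ is the curvature tensor of the Chern connection; equivalently $s_g=\mathrm{tr}_{\omega_g}\left(-\sqrt{-1}\,\partial\bar\partial\log\det(g_{i\bar j})\right)$. The complex Laplacian on smooth functions is $\square_g f=\mathrm{tr}_{\omega_g}(\sqrt{-1}\,\partial\bar\partial f)=g^{i\bar j}\frac{\partial^2 f}{\partial z^i\partial\bar z^j}$, and $\square_g^*$ is its formal adjoint with respect to the $L^2$ inner product defined by the volume form $\omega_g^n/n!$. For real $p>1$ the $p$-Calabi functional is $$C_p(\omega_g)=\left(\int_M|s_g|^p\frac{\omega_g^n}{n!}\right)\left(\int_M\frac{\omega_g^n}{n!}\right)^{-\frac{n-p}{n}}.$$ The metric $\omega_g$ is called $p$-conformal extremal if $\left.\frac{d}{dt}\right|_{t=0}C_p(e^{tf}\omega_g)=0$ for every $f\in C^\infty(M,\mathbb R)$. The function $s_g|s_g|^{p-2}$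 is understood to be $0$ where $s_g=0$ (it is continuous since $p>1$). The equation $\square_g^*u=h$, with $u,h$ continuous, holds in the sense of distributions if $\int_M u\,\square_g f\,\frac{\omega_g^n}{n!}=\int_M h f\,\frac{\omega_g^n}{n!}$ for all $f\in C^\infty(M,\mathbb R)$. *)

theory Defs
  imports "HOL-Analysis.Analysis"
begin

section \<open>Smooth and holomorphic maps\<close>

text \<open>\<open>S\<close> is meant to be open: derivatives are taken at points, not within \<open>S\<close>.\<close>

primrec C_k_on :: "nat \<Rightarrow> 'a::real_normed_vector set \<Rightarrow> ('a \<Rightarrow> 'b::real_normed_vector) \<Rightarrow> bool" where
  "C_k_on 0 S f \<longleftrightarrow> continuous_on S f"
| "C_k_on (Suc k) S f \<longleftrightarrow> (\<forall>x\<in>S. f differentiable (at x)) \<and>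
     (\<forall>v. C_k_on k S (\<lambda>x. frechet_derivative f (at x) v))"

definition smooth_on :: "'a::real_normed_vector set \<Rightarrow> ('a \<Rightarrow> 'b::real_normed_vector) \<Rightarrow> bool" where
  "smooth_on S f \<longleftrightarrow> (\<forall>k. C_k_on k S f)"

definition holomorphic_map_on ::
    "(complex^'n) set \<Rightarrow> (complex^'n \<Rightarrow> complex^'m) \<Rightarrow> bool" where
  "holomorphic_map_on S F \<longleftrightarrow> smooth_on S F \<and>
     (\<forall>z\<in>S. \<forall>a v. frechet_derivative F (at z) (a *s v) = a *s frechet_derivative F (at z) v)"

section \<open>Complex manifolds\<close>

type_synonym ('a, 'n) chart = "'a set \<times> ('a \<Rightarrow> complex^'n)"

abbreviation chart_dom :: "('a, 'n) chart \<Rightarrow> 'a set" where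
  "chart_dom \<equiv> fst"

abbreviation chart_map :: "('a, 'n) chart \<Rightarrow> 'a \<Rightarrow> complex^'n" where
  "chart_map \<equiv> snd"

definition chart_image :: "('a, 'n) chart \<Rightarrow> (complex^'n) set" where
  "chart_image c = chart_map c ` chart_dom c"

definition chart_inv :: "('a, 'n) chart \<Rightarrow> complex^'n \<Rightarrow> 'a" where
  "chart_inv c = inv_into (chart_dom c) (chart_map c)"

definition complex_chart :: "'a topology \<Rightarrow> ('a, 'n::finite) chart \<Rightarrow> bool" where
  "complex_chart M c \<longleftrightarrow> openin M (chart_dom c) \<and> open (chart_image c) \<and>
     homeomorphic_map (subtopology M (chart_dom c)) (top_of_set (chart_image c)) (chart_map c)"

text \<open>Second countability is not demanded; for compact \<open>M\<close> it is automatic.\<close>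

definition complex_manifold :: "'a topology \<Rightarrow> ('a, 'n::finite) chart set \<Rightarrow> bool" where
  "complex_manifold M A \<longleftrightarrow>
     Hausdorff_space M \<and>
     (\<forall>c\<in>A. complex_chart M c) \<and>
     topspace M = (\<Union>c\<in>A. chart_dom c) \<and>
     (\<forall>c\<in>A. \<forall>d\<in>A. holomorphic_map_on
        (chart_map c ` (chart_dom c \<inter> chart_dom d)) (chart_map d \<circ> chart_inv c))"

definition chart_at :: "('a, 'n) chart set \<Rightarrow> 'a \<Rightarrow> ('a, 'n) chart" where
  "chart_at A x = (SOME c. c \<in> A \<and> x \<in> chart_dom c)"

text \<open>Smoothness of a function defined on the domain of a single chart, and on the manifold.\<close>

definition smooth_in_chart ::
    "('a, 'n::finite) chart \<Rightarrow> ('a \<Rightarrow> 'b::real_normed_vector) \<Rightarrow> bool" where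
  "smooth_in_chart c f \<longleftrightarrow> smooth_on (chart_image c) (f \<circ> chart_inv c)"

definition smooth_function :: "('a, 'n::finite) chart set \<Rightarrow> ('a \<Rightarrow> real) \<Rightarrow> bool" where
  "smooth_function A f \<longleftrightarrow> (\<forall>c\<in>A. smooth_in_chart c f)"

text \<open>The derivatives \<open>\<partial>/\<partial>z\<^sup>i = (\<partial>/\<partial>x\<^sup>i - \<i> \<partial>/\<partial>y\<^sup>i)/2\<close> and
  \<open>\<partial>/\<partial>z\<^sup>i\<close>-bar \<open>= (\<partial>/\<partial>x\<^sup>i + \<i> \<partial>/\<partial>y\<^sup>i)/2\<close> in the coordinates
  \<open>z\<^sup>i = x\<^sup>i + \<i> y\<^sup>i\<close> of the chart \<open>c\<close>.\<close>

definition d_z :: "('a, 'n::finite) chart \<Rightarrow> 'n \<Rightarrow> ('a \<Rightarrow> complex) \<Rightarrow> 'a \<Rightarrow> complex" where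
  "d_z c i f x = (let D = frechet_derivative (f \<circ> chart_inv c) (at (chart_map c x))
     in (D (axis i 1) - \<i> * D (axis i \<i>)) / 2)"

definition d_zbar :: "('a, 'n::finite) chart \<Rightarrow> 'n \<Rightarrow> ('a \<Rightarrow> complex) \<Rightarrow> 'a \<Rightarrow> complex" where
  "d_zbar c i f x = (let D = frechet_derivative (f \<circ> chart_inv c) (at (chart_map c x))
     in (D (axis i 1) + \<i> * D (axis i \<i>)) / 2)"

section \<open>Hermitian metrics\<close>

text \<open>A metric is given by its component matrices: \<open>g c x $ i $ j\<close> is the component of index
  \<open>i\<close>, \<open>j\<close>-bar in the chart \<open>c\<close> at the point \<open>x\<close>.\<close>

type_synonym ('a, 'n) metric = "('a, 'n) chart \<Rightarrow> 'a \<Rightarrow> complex^'n^'n"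

definition hermitian_pos_def :: "complex^'n::finite^'n \<Rightarrow> bool" where
  "hermitian_pos_def G \<longleftrightarrow> (\<forall>i j. G $ j $ i = cnj (G $ i $ j)) \<and>
     (\<forall>v. v \<noteq> 0 \<longrightarrow> 0 < Re (\<Sum>i\<in>UNIV. \<Sum>j\<in>UNIV. G $ i $ j * v $ i * cnj (v $ j)))"

definition hermitian_metric :: "('a, 'n::finite) chart set \<Rightarrow> ('a, 'n) metric \<Rightarrow> bool" where
  "hermitian_metric A g \<longleftrightarrow>
     (\<forall>c\<in>A. (\<forall>i j. smooth_in_chart c (\<lambda>x. g c x $ i $ j)) \<and>
             (\<forall>x\<in>chart_dom c. hermitian_pos_def (g c x))) \<and>
     (\<forall>c\<in>A. \<forall>d\<in>A. \<forall>x\<in>chart_dom c \<inter> chart_dom d. \<forall>i j.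
        g c x $ i $ j = (\<Sum>k\<in>UNIV. \<Sum>l\<in>UNIV.
          d_z c i (\<lambda>y. chart_map d y $ k) x * cnj (d_z c j (\<lambda>y. chart_map d y $ l) x)
          * g d x $ k $ l))"

definition conformal_metric :: "('a \<Rightarrow> real) \<Rightarrow> ('a, 'n::finite) metric \<Rightarrow> ('a, 'n) metric" where
  "conformal_metric f g = (\<lambda>c x. exp (f x) *\<^sub>R g c x)"

text \<open>The component of index \<open>i\<close>, \<open>j\<close>-bar of the inverse metric. It is normalised by
  \<open>(\<Sum>j. g_upper g c i j x * g c x $ k $ j) = (if i = k then 1 else 0)\<close>, hence the
  transposition.\<close>

definition g_upper ::
    "('a, 'n::finite) metric \<Rightarrow> ('a, 'n) chart \<Rightarrow> 'n \<Rightarrow> 'n \<Rightarrow> 'a \<Rightarrow> complex" where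
  "g_upper g c i j x = matrix_inv (g c x) $ j $ i"

text \<open>In the holomorphic frame \<open>\<partial>/\<partial>z\<^sup>k\<close> the Chern connection of the metric is
  \<open>\<nabla>\<^sub>i \<partial>\<^sub>k = (\<Sum>l. chern_Gamma g c l i k * \<partial>\<^sub>l)\<close>, with connection matrix
  \<open>\<partial>g g\<close>-inverse of type (1,0). Its curvature is the \<open>\<partial>\<close>-bar derivative of that
  matrix; the minus sign comes from writing \<open>dz\<^sup>i\<close> before \<open>dz\<^sup>j\<close>-bar.\<close>

definition chern_Gamma ::
    "('a, 'n::finite) metric \<Rightarrow> ('a, 'n) chart \<Rightarrow> 'n \<Rightarrow> 'n \<Rightarrow> 'n \<Rightarrow> 'a \<Rightarrow> complex" where
  "chern_Gamma g c l i k x =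
     (\<Sum>q\<in>UNIV. g_upper g c l q x * d_z c i (\<lambda>y. g c y $ k $ q) x)"

definition chern_curvature ::
    "('a, 'n::finite) metric \<Rightarrow> ('a, 'n) chart \<Rightarrow> 'n \<Rightarrow> 'n \<Rightarrow> 'n \<Rightarrow> 'n \<Rightarrow> 'a \<Rightarrow> complex" where
  "chern_curvature g c i j k l x =
     (\<Sum>m\<in>UNIV. g c x $ m $ l * (- d_zbar c j (chern_Gamma g c m i k) x))"

text \<open>The two contractions below are real and do not depend on the chart; \<open>Re\<close> only
  changes the type.\<close>

definition chern_scalar ::
    "('a, 'n::finite) chart set \<Rightarrow> ('a, 'n) metric \<Rightarrow> 'a \<Rightarrow> real" where
  "chern_scalar A g x = (let c = chart_at A x in
     Re (\<Sum>i\<in>UNIV. \<Sum>j\<in>UNIV. \<Sum>k\<in>UNIV. \<Sum>l\<in>UNIV.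
       g_upper g c i j x * g_upper g c k l x * chern_curvature g c i j k l x))"

definition complex_laplacian ::
    "('a, 'n::finite) chart set \<Rightarrow> ('a, 'n) metric \<Rightarrow> ('a \<Rightarrow> real) \<Rightarrow> 'a \<Rightarrow> real" where
  "complex_laplacian A g f x = (let c = chart_at A x in
     Re (\<Sum>i\<in>UNIV. \<Sum>j\<in>UNIV.
       g_upper g c i j x * d_z c i (d_zbar c j (\<lambda>y. complex_of_real (f y))) x))"

section \<open>Integration against the volume form\<close>

definition partition_of_unity ::
    "'a topology \<Rightarrow> ('a, 'n::finite) chart set \<Rightarrow> ('a, 'n) chart set
      \<Rightarrow> (('a, 'n) chart \<Rightarrow> 'a \<Rightarrow> real) \<Rightarrow> bool" where
  "partition_of_unity M A I \<rho> \<longleftrightarrow> finite I \<and> I \<subseteq> A \<and>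
     (\<forall>c\<in>I. continuous_map M euclideanreal (\<rho> c) \<and>
        (\<forall>x\<in>topspace M. 0 \<le> \<rho> c x) \<and>
        M closure_of {x \<in> topspace M. \<rho> c x \<noteq> 0} \<subseteq> chart_dom c) \<and>
     (\<forall>x\<in>topspace M. (\<Sum>c\<in>I. \<rho> c x) = 1)"

text \<open>Since \<open>\<i> dz \<and> dz\<close>-bar \<open>= 2 dx \<and> dy\<close>, the form \<open>\<omega>\<^sup>n/n!\<close> has
  density \<open>2\<^sup>n det g\<close> with respect to Lebesgue measure in a chart.\<close>

definition vol_density :: "('a, 'n::finite) metric \<Rightarrow> ('a, 'n) chart \<Rightarrow> 'a \<Rightarrow> real" where
  "vol_density g c x = 2 ^ CARD('n) * Re (det (g c x))"

text \<open>The integral of \<open>h \<omega>\<^sup>n/n!\<close> over a compact manifold, for continuous \<open>h\<close>. A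
  finite partition of unity subordinate to the atlas exists by compactness, and by the change of
  variables formula the value does not depend on the one chosen.\<close>

definition integral_M ::
    "'a topology \<Rightarrow> ('a, 'n::finite) chart set \<Rightarrow> ('a, 'n) metric \<Rightarrow> ('a \<Rightarrow> real) \<Rightarrow> real" where
  "integral_M M A g h =
     (case (SOME (I, \<rho>). partition_of_unity M A I \<rho>) of (I, \<rho>) \<Rightarrow>
       \<Sum>c\<in>I. LINT z:chart_image c|lborel.
         \<rho> c (chart_inv c z) * h (chart_inv c z) * vol_density g c (chart_inv c z))"

section \<open>The Calabi functional and the extremal equation\<close>

definition calabi_functional ::
    "'a topology \<Rightarrow> ('a, 'n::finite) chart set \<Rightarrow> real \<Rightarrow> ('a, 'n) metric \<Rightarrow> real" where
  "calabi_functional M A p g =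
     integral_M M A g (\<lambda>x. \<bar>chern_scalar A g x\<bar> powr p) *
     integral_M M A g (\<lambda>x. 1) powr (- ((real CARD('n) - p) / real CARD('n)))"

definition p_conformal_extremal ::
    "'a topology \<Rightarrow> ('a, 'n::finite) chart set \<Rightarrow> real \<Rightarrow> ('a, 'n) metric \<Rightarrow> bool" where
  "p_conformal_extremal M A p g \<longleftrightarrow>
     (\<forall>f. smooth_function A f \<longrightarrow>
       ((\<lambda>t. calabi_functional M A p (conformal_metric (\<lambda>x. t * f x) g))
          has_real_derivative 0) (at 0))"

text \<open>The equation \<open>\<box>\<^sup>* u = h\<close> in the sense of distributions, for continuous \<open>u\<close> and
  \<open>h\<close>.\<close>

definition adjoint_laplacian_eq ::
    "'a topology \<Rightarrow> ('a, 'n::finite) chart set \<Rightarrow> ('a, 'n) metric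
      \<Rightarrow> ('a \<Rightarrow> real) \<Rightarrow> ('a \<Rightarrow> real) \<Rightarrow> bool" where
  "adjoint_laplacian_eq M A g u h \<longleftrightarrow>
     (\<forall>f. smooth_function A f \<longrightarrow>
       integral_M M A g (\<lambda>x. u x * complex_laplacian A g f x) =
       integral_M M A g (\<lambda>x. h x * f x))"

end

theory Submission
  imports Defs
begin

text \<open>
Under a conformal change of the metric \<open>g\<close> by the factor \<open>e\<^sup>u\<close>, in complex dimension \<open>n\<close>, the volume
form is multiplied by \<open>e\<^bsup>nu\<^esup>\<close> and the Chern scalar curvature becomes \<open>e\<^bsup>-u\<^esup> (s - n \<box>u)\<close>
(\<open>chern_scalar_conformal\<close>). The reason is that \<open>s\<close> is the trace of \<open>-\<i>\<partial>\<partial>-bar log det g\<close> and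
\<open>log det (e\<^sup>u g) = n u + log det g\<close>. Hence
\<open>C\<^sub>p (e\<^bsup>tf\<^esup> g) = (\<integral> e\<^bsup>(n-p)tf\<^esup> \<bar>s - n t \<box>f\<bar>\<^sup>p) (\<integral> e\<^bsup>ntf\<^esup>)\<^bsup>-(n-p)/n\<^esup>\<close>, with integrals against the volume
form of \<open>g\<close>. Differentiating at \<open>t = 0\<close> gives, up to the positive factor
\<open>V\<^bsup>-(n-p)/n\<^esup>\<close> with \<open>V\<close> the volume,
\<open>(n - p) \<integral> (\<bar>s\<bar>\<^sup>p - (\<integral> \<bar>s\<bar>\<^sup>p) / V) f - n p \<integral> s \<bar>s\<bar>\<^bsup>p-2\<^esup> \<box>f\<close>
(\<open>first_variation\<close>), and its vanishing for all \<open>f\<close> is the equation in the sense of distributions.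

Two points need work. First, the derivative of \<open>\<bar>a\<bar>\<^sup>p\<close> exists also at zeros of \<open>a\<close>, as \<open>p > 1\<close>, and
differentiation under the integral sign requires the integrands to be continuous on each chart. The
curvature and the Laplacian are computed in a chart chosen separately for each point, so their
continuity rests on their invariance under holomorphic changes of coordinates
(\<open>coord_scalar_invariant\<close>, \<open>coord_laplacian_invariant\<close>). These in turn use the chain rule for
Wirtinger derivatives and the symmetry of second derivatives. Second, integrals are defined by a
partition of unity, which has to be constructed (\<open>compact_manifold_partition_of_unity\<close>); the
positivity of the volume follows from that of determinants of positive definite Hermitian matrices.
\<close>

section \<open>Calculus of smooth functions\<close>

lemma frechet_derivative_eqI:
  "(f has_derivative f') (at x) \<Longrightarrow> frechet_derivative f (at x) = f'"
  by (metis frechet_derivative_at)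

lemma frechet_derivative_cong_open:
  assumes "open S" "x \<in> S" "\<And>y. y \<in> S \<Longrightarrow> f y = g y"
  shows "frechet_derivative f (at x) = frechet_derivative g (at x)"
proof -
  have "(f has_derivative D) (at x) \<longleftrightarrow> (g has_derivative D) (at x)" for D
    using has_derivative_transform_within_open[OF _ assms(1,2)] assms(3) by metis
  then show ?thesis unfolding frechet_derivative_def by simp
qed

lemma differentiable_cong_open:
  assumes "open S" "x \<in> S" "\<And>y. y \<in> S \<Longrightarrow> f y = g y" "f differentiable (at x)"
  shows "g differentiable (at x)"
  using assms has_derivative_transform_within_open[OF _ assms(1,2)] unfolding differentiable_def by metis

text \<open>Openness of the set matters in all closure properties below: the derivative is taken at points, so
it is determined by the values on the set only if the set is a neighbourhood of each of its points.\<close>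

lemma C_k_on_cong:
  assumes "open S" "\<And>x. x \<in> S \<Longrightarrow> f x = g x" "C_k_on k S f"
  shows "C_k_on k S g"
  using assms(2,3)
proof (induction k arbitrary: f g)
  case 0
  then show ?case by (simp cong: continuous_on_cong)
next
  case (Suc k)
  have "frechet_derivative f (at x) = frechet_derivative g (at x)" if "x \<in> S" for x
    using frechet_derivative_cong_open[OF assms(1) that] Suc.prems(1) by blast
  then have "C_k_on k S (\<lambda>x. frechet_derivative g (at x) v)" for v
    using Suc.IH[of "\<lambda>x. frechet_derivative f (at x) v" "\<lambda>x. frechet_derivative g (at x) v"] Suc.prems(2)
    by simp
  moreover have "g differentiable (at x)" if "x \<in> S" for x
    using differentiable_cong_open[OF assms(1) that] Suc.prems that by (metis C_k_on.simps(2))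
  ultimately show ?case by simp
qed

lemma C_k_on_Suc_imp: "C_k_on (Suc k) S f \<Longrightarrow> C_k_on k S f"
proof (induction k arbitrary: f)
  case 0
  then show ?case
    by (auto simp: continuous_on_eq_continuous_at differentiable_imp_continuous_within
        intro!: continuous_at_imp_continuous_on)
next
  case (Suc k)
  then show ?case by (simp only: C_k_on.simps) blast
qed

lemma C_k_on_const: "C_k_on k S (\<lambda>x. c)"
  by (induction k arbitrary: c) auto

lemma C_k_on_bounded_linear:
  assumes "open S" "bounded_linear L" "C_k_on k S f"
  shows "C_k_on k S (\<lambda>x. L (f x))"
  using assms(3)
proof (induction k arbitrary: f)
  case 0
  then show ?case using bounded_linear.continuous_on[OF assms(2)] by auto
next
  case (Suc k)
  have D: "((\<lambda>x. L (f x)) has_derivative (\<lambda>v. L (frechet_derivative f (at x) v))) (at x)" if "x \<in> S" for x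
    using Suc.prems that by (auto simp: frechet_derivative_works intro!: bounded_linear.has_derivative[OF assms(2)])
  have "C_k_on k S (\<lambda>x. frechet_derivative (\<lambda>x. L (f x)) (at x) v)" for v
    by (rule C_k_on_cong[OF assms(1), of "\<lambda>x. L (frechet_derivative f (at x) v)"])
       (use Suc D[THEN frechet_derivative_eqI] in auto)
  then show ?case using D by (auto simp: differentiable_def)
qed

lemma C_k_on_add:
  assumes "open S" "C_k_on k S f" "C_k_on k S g"
  shows "C_k_on k S (\<lambda>x. f x + g x)"
  using assms(2,3)
proof (induction k arbitrary: f g)
  case 0
  then show ?case by (auto intro: continuous_intros)
next
  case (Suc k)
  have D: "((\<lambda>x. f x + g x) has_derivative
      (\<lambda>v. frechet_derivative f (at x) v + frechet_derivative g (at x) v)) (at x)" if "x \<in> S" for x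
    using Suc.prems that by (auto simp: frechet_derivative_works intro!: has_derivative_add)
  have "C_k_on k S (\<lambda>x. frechet_derivative (\<lambda>x. f x + g x) (at x) v)" for v
    by (rule C_k_on_cong[OF assms(1), of "\<lambda>x. frechet_derivative f (at x) v + frechet_derivative g (at x) v"])
       (use Suc D[THEN frechet_derivative_eqI] in auto)
  then show ?case using D by (auto simp: differentiable_def)
qed

text \<open>The product rule brings back the factors themselves, which is why the induction step needs that
\<open>C_k_on (Suc k)\<close> implies \<open>C_k_on k\<close>. The same holds for the inverse and the exponential, whose
derivatives contain the function itself.\<close>

lemma C_k_on_mult:
  fixes f g :: "'a::real_normed_vector \<Rightarrow> 'b::real_normed_algebra"
  assumes "open S" "C_k_on k S f" "C_k_on k S g"
  shows "C_k_on k S (\<lambda>x. f x * g x)"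
  using assms(2,3)
proof (induction k arbitrary: f g)
  case 0
  then show ?case by (auto intro: continuous_intros)
next
  case (Suc k)
  have D: "((\<lambda>x. f x * g x) has_derivative
      (\<lambda>v. f x * frechet_derivative g (at x) v + frechet_derivative f (at x) v * g x)) (at x)" if "x \<in> S" for x
    using Suc.prems that by (auto simp: frechet_derivative_works intro!: has_derivative_mult)
  have "C_k_on k S f" "C_k_on k S g" using Suc.prems C_k_on_Suc_imp by blast+
  then have *: "C_k_on k S (\<lambda>x. f x * frechet_derivative g (at x) v + frechet_derivative f (at x) v * g x)" for v
    using Suc by (intro C_k_on_add[OF assms(1)]) auto
  have "C_k_on k S (\<lambda>x. frechet_derivative (\<lambda>x. f x * g x) (at x) v)" for v
    by (rule C_k_on_cong[OF assms(1) _ *[of v]]) (use D[THEN frechet_derivative_eqI] in auto)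
  then show ?case using D by (auto simp: differentiable_def)
qed

lemma C_k_on_inverse:
  fixes f :: "'a::real_normed_vector \<Rightarrow> 'b::real_normed_field"
  assumes "open S" "C_k_on k S f" "\<And>x. x \<in> S \<Longrightarrow> f x \<noteq> 0"
  shows "C_k_on k S (\<lambda>x. inverse (f x))"
  using assms(2)
proof (induction k)
  case 0
  then show ?case using assms(3) by (auto intro: continuous_intros)
next
  case (Suc k)
  have D: "((\<lambda>x. inverse (f x)) has_derivative
      (\<lambda>v. - (inverse (f x) * frechet_derivative f (at x) v * inverse (f x)))) (at x)" if "x \<in> S" for x
    using Suc.prems that assms(3) by (auto simp: frechet_derivative_works intro!: has_derivative_inverse)
  have k: "C_k_on k S (\<lambda>x. inverse (f x))"
    using Suc C_k_on_Suc_imp by blast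
  have "C_k_on k S (\<lambda>x. frechet_derivative (\<lambda>x. inverse (f x)) (at x) v)" for v
  proof (rule C_k_on_cong[OF assms(1), of "\<lambda>x. - (inverse (f x) * frechet_derivative f (at x) v * inverse (f x))"])
    show "C_k_on k S (\<lambda>x. - (inverse (f x) * frechet_derivative f (at x) v * inverse (f x)))"
      using Suc.prems
      by (intro C_k_on_bounded_linear[OF assms(1) bounded_linear_minus[OF bounded_linear_ident]]
          C_k_on_mult[OF assms(1)] k) auto
  qed (use D[THEN frechet_derivative_eqI] in auto)
  then show ?case using D by (auto simp: differentiable_def)
qed

lemma C_k_on_exp:
  fixes f :: "'a::real_normed_vector \<Rightarrow> complex"
  assumes "open S" "C_k_on k S f"
  shows "C_k_on k S (\<lambda>x. exp (f x))"
  using assms(2)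
proof (induction k)
  case 0
  then show ?case by (auto intro: continuous_intros)
next
  case (Suc k)
  have D: "((\<lambda>x. exp (f x)) has_derivative (\<lambda>v. exp (f x) * frechet_derivative f (at x) v)) (at x)"
    if "x \<in> S" for x
  proof -
    have "(f has_derivative frechet_derivative f (at x)) (at x)"
      using Suc.prems that by (auto simp: frechet_derivative_works)
    moreover have "(exp has_derivative (*) (exp (f x))) (at (f x))"
      using DERIV_exp[of "f x"] by (simp add: has_field_derivative_def)
    ultimately show ?thesis by (rule has_derivative_compose)
  qed
  have k: "C_k_on k S (\<lambda>x. exp (f x))"
    using Suc C_k_on_Suc_imp by blast
  have "C_k_on k S (\<lambda>x. frechet_derivative (\<lambda>x. exp (f x)) (at x) v)" for v
  proof (rule C_k_on_cong[OF assms(1), of "\<lambda>x. exp (f x) * frechet_derivative f (at x) v"])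
    show "C_k_on k S (\<lambda>x. exp (f x) * frechet_derivative f (at x) v)"
      using Suc.prems by (intro C_k_on_mult[OF assms(1)] k) auto
  qed (use D[THEN frechet_derivative_eqI] in auto)
  then show ?case using D by (auto simp: differentiable_def)
qed

lemma C_k_on_subset: "C_k_on k S f \<Longrightarrow> T \<subseteq> S \<Longrightarrow> C_k_on k T f"
  by (induction k arbitrary: f) (auto intro: continuous_on_subset)

lemma smooth_on_cong:
  "open S \<Longrightarrow> smooth_on S f \<Longrightarrow> (\<And>x. x \<in> S \<Longrightarrow> f x = g x) \<Longrightarrow> smooth_on S g"
  unfolding smooth_on_def using C_k_on_cong by metis

lemma smooth_on_subset: "smooth_on S f \<Longrightarrow> T \<subseteq> S \<Longrightarrow> smooth_on T f"
  unfolding smooth_on_def using C_k_on_subset by blast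

lemma smooth_on_const [simp]: "smooth_on S (\<lambda>x. c)"
  unfolding smooth_on_def using C_k_on_const by blast

lemma smooth_on_bounded_linear:
  "open S \<Longrightarrow> bounded_linear L \<Longrightarrow> smooth_on S f \<Longrightarrow> smooth_on S (\<lambda>x. L (f x))"
  unfolding smooth_on_def using C_k_on_bounded_linear by blast

lemma smooth_on_add: "open S \<Longrightarrow> smooth_on S f \<Longrightarrow> smooth_on S g \<Longrightarrow> smooth_on S (\<lambda>x. f x + g x)"
  unfolding smooth_on_def using C_k_on_add by blast

lemma smooth_on_mult:
  fixes f g :: "'a::real_normed_vector \<Rightarrow> 'b::real_normed_algebra"
  shows "open S \<Longrightarrow> smooth_on S f \<Longrightarrow> smooth_on S g \<Longrightarrow> smooth_on S (\<lambda>x. f x * g x)"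
  unfolding smooth_on_def using C_k_on_mult by blast

lemma smooth_on_inverse:
  fixes f :: "'a::real_normed_vector \<Rightarrow> 'b::real_normed_field"
  shows "open S \<Longrightarrow> smooth_on S f \<Longrightarrow> (\<And>x. x \<in> S \<Longrightarrow> f x \<noteq> 0) \<Longrightarrow> smooth_on S (\<lambda>x. inverse (f x))"
  unfolding smooth_on_def using C_k_on_inverse by blast

lemma smooth_on_exp:
  fixes f :: "'a::real_normed_vector \<Rightarrow> complex"
  shows "open S \<Longrightarrow> smooth_on S f \<Longrightarrow> smooth_on S (\<lambda>x. exp (f x))"
  unfolding smooth_on_def using C_k_on_exp by blast

lemma smooth_on_sum:
  "open S \<Longrightarrow> (\<And>i. i \<in> I \<Longrightarrow> smooth_on S (f i)) \<Longrightarrow> smooth_on S (\<lambda>x. \<Sum>i\<in>I. f i x)"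
  by (induction I rule: infinite_finite_induct) (auto intro: smooth_on_add)

lemma smooth_on_prod:
  fixes f :: "'i \<Rightarrow> 'a::real_normed_vector \<Rightarrow> 'b::real_normed_field"
  shows "open S \<Longrightarrow> (\<And>i. i \<in> I \<Longrightarrow> smooth_on S (f i)) \<Longrightarrow> smooth_on S (\<lambda>x. \<Prod>i\<in>I. f i x)"
  by (induction I rule: infinite_finite_induct) (auto intro: smooth_on_mult)

lemma smooth_on_frechet_derivative:
  "smooth_on S f \<Longrightarrow> smooth_on S (\<lambda>x. frechet_derivative f (at x) v)"
  unfolding smooth_on_def by (metis C_k_on.simps(2))

lemma smooth_on_imp_differentiable: "smooth_on S f \<Longrightarrow> x \<in> S \<Longrightarrow> f differentiable (at x)"
  unfolding smooth_on_def by (metis C_k_on.simps(2))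

lemma smooth_on_imp_continuous_on: "smooth_on S f \<Longrightarrow> continuous_on S f"
  unfolding smooth_on_def by (metis C_k_on.simps(1))

text \<open>The left-hand side of the equation is symmetric in \<open>v\<close> and \<open>w\<close>. Two applications of the mean
value theorem, first along \<open>v\<close> and then along \<open>w\<close>, express it by one of the two mixed second
derivatives; exchanging the directions expresses it by the other.\<close>

lemma second_difference_mean_value:
  fixes f :: "'a::real_normed_vector \<Rightarrow> real"
  assumes S: "ball z r \<subseteq> S" and f: "C_k_on 2 S f"
    and h: "h > 0" "h * (norm v + norm w) < r"
  shows "\<exists>\<xi> \<eta>. 0 < \<xi> \<and> \<xi> < h \<and> 0 < \<eta> \<and> \<eta> < h \<and>
    f (z + h *\<^sub>R v + h *\<^sub>R w) - f (z + h *\<^sub>R v) - f (z + h *\<^sub>R w) + f z =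
      h * h * frechet_derivative (\<lambda>x. frechet_derivative f (at x) v) (at (z + \<xi> *\<^sub>R v + \<eta> *\<^sub>R w)) w"
proof -
  let ?D = "\<lambda>x. frechet_derivative f (at x) v"
  have inS: "z + s *\<^sub>R v + t *\<^sub>R w \<in> S" if "0 \<le> s" "s \<le> h" "0 \<le> t" "t \<le> h" for s t
  proof -
    have "norm (s *\<^sub>R v + t *\<^sub>R w) \<le> s * norm v + t * norm w"
      using norm_triangle_ineq[of "s *\<^sub>R v" "t *\<^sub>R w"] that by simp
    also have "\<dots> \<le> h * norm v + h * norm w"
      by (intro add_mono mult_right_mono) (use that in auto)
    finally have "norm (s *\<^sub>R v + t *\<^sub>R w) < r" using h(2) by (simp add: distrib_left)
    moreover have "dist z (z + s *\<^sub>R v + t *\<^sub>R w) = norm (s *\<^sub>R v + t *\<^sub>R w)"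
      by (simp add: dist_norm add.assoc norm_uminus_minus)
    ultimately show ?thesis using S by (auto simp: subset_iff)
  qed
  have df: "(f has_derivative frechet_derivative f (at x)) (at x)"
    and dD: "(?D has_derivative frechet_derivative ?D (at x)) (at x)" if "x \<in> S" for x
    using f that by (auto simp: numeral_2_eq_2 frechet_derivative_works)
  have line: "((\<lambda>t. F (a + t *\<^sub>R u)) has_real_derivative F' u) (at t)"
    if "(F has_derivative F') (at (a + t *\<^sub>R u))" for F F' and a u :: 'a and t
  proof -
    have "((\<lambda>t. F (a + t *\<^sub>R u)) has_derivative (\<lambda>s. F' (s *\<^sub>R u))) (at t)"
      by (rule has_derivative_compose[of "\<lambda>t. a + t *\<^sub>R u" "\<lambda>s. s *\<^sub>R u" t UNIV F F', OF _ that])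
         (auto intro!: derivative_eq_intros)
    moreover have "(\<lambda>s. F' (s *\<^sub>R u)) = (*) (F' u)"
      using has_derivative_bounded_linear[OF that]
      by (auto simp: fun_eq_iff linear_scale[OF bounded_linear.linear])
    ultimately show ?thesis by (simp add: has_field_derivative_def)
  qed
  let ?g = "\<lambda>s. f (z + h *\<^sub>R w + s *\<^sub>R v) - f (z + s *\<^sub>R v)"
  have "\<exists>\<xi>>0. \<xi> < h \<and> ?g h - ?g 0 = (h - 0) * (?D (z + h *\<^sub>R w + \<xi> *\<^sub>R v) - ?D (z + \<xi> *\<^sub>R v))"
  proof (rule MVT2)
    fix s assume "0 \<le> s" "s \<le> h"
    then show "(?g has_real_derivative ?D (z + h *\<^sub>R w + s *\<^sub>R v) - ?D (z + s *\<^sub>R v)) (at s)"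
      using inS[of s h] inS[of s 0] h(1)
      by (intro DERIV_diff line df) (auto simp: algebra_simps)
  qed (use h in auto)
  then obtain \<xi> where \<xi>: "0 < \<xi>" "\<xi> < h"
    "?g h - ?g 0 = h * (?D (z + h *\<^sub>R w + \<xi> *\<^sub>R v) - ?D (z + \<xi> *\<^sub>R v))" by auto
  let ?k = "\<lambda>t. ?D (z + \<xi> *\<^sub>R v + t *\<^sub>R w)"
  have "\<exists>\<eta>>0. \<eta> < h \<and> ?k h - ?k 0 = (h - 0) * frechet_derivative ?D (at (z + \<xi> *\<^sub>R v + \<eta> *\<^sub>R w)) w"
  proof (rule MVT2)
    fix t assume "0 \<le> t" "t \<le> h"
    then show "(?k has_real_derivative frechet_derivative ?D (at (z + \<xi> *\<^sub>R v + t *\<^sub>R w)) w) (at t)"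
      using inS[of \<xi> t] \<xi> by (intro line dD) auto
  qed (use h in auto)
  then obtain \<eta> where \<eta>: "0 < \<eta>" "\<eta> < h"
    "?k h - ?k 0 = h * frechet_derivative ?D (at (z + \<xi> *\<^sub>R v + \<eta> *\<^sub>R w)) w" by auto
  have "?g h - ?g 0 = h * (?k h - ?k 0)" using \<xi>(3) by (simp add: algebra_simps)
  then show ?thesis
    using \<xi> \<eta> by (intro exI[of _ \<xi>] exI[of _ \<eta>]) (simp add: algebra_simps)
qed

text \<open>Schwarz's theorem: both mixed derivatives take a common value (the second difference quotient) at
points arbitrarily close to \<open>z\<close>, so by continuity they agree at \<open>z\<close>.\<close>

lemma second_derivative_symmetric_real:
  fixes f :: "'a::real_normed_vector \<Rightarrow> real"
  assumes S: "open S" "z \<in> S" and f: "C_k_on 2 S f"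
  shows "frechet_derivative (\<lambda>x. frechet_derivative f (at x) v) (at z) w =
         frechet_derivative (\<lambda>x. frechet_derivative f (at x) w) (at z) v"
proof (rule ccontr)
  let ?P = "\<lambda>v w x. frechet_derivative (\<lambda>x. frechet_derivative f (at x) v) (at x) w"
  assume "?P v w z \<noteq> ?P w v z"
  define e where "e = \<bar>?P v w z - ?P w v z\<bar> / 2"
  have e: "e > 0" using \<open>?P v w z \<noteq> ?P w v z\<close> by (simp add: e_def)
  have cont: "isCont (?P v w) z" for v w
    using f S by (auto simp: numeral_2_eq_2 continuous_on_eq_continuous_at)
  have near: "\<exists>d>0. \<forall>x. dist x z < d \<longrightarrow> \<bar>?P v w x - ?P v w z\<bar> < e" for v w
    using cont[of v w] e unfolding continuous_at_eps_delta dist_real_def by metis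
  obtain d1 where d1: "d1 > 0" "\<And>x. dist x z < d1 \<Longrightarrow> \<bar>?P v w x - ?P v w z\<bar> < e" using near by metis
  obtain d2 where d2: "d2 > 0" "\<And>x. dist x z < d2 \<Longrightarrow> \<bar>?P w v x - ?P w v z\<bar> < e" using near by metis
  obtain r0 where r0: "r0 > 0" "ball z r0 \<subseteq> S" using S openE by blast
  define r where "r = min r0 (min d1 d2)"
  have r: "r > 0" "ball z r \<subseteq> S" using r0 d1 d2 by (auto simp: r_def)
  \<comment> \<open>Adding 1 keeps the denominator positive when both directions vanish.\<close>
  define h where "h = r / (2 * (norm v + norm w + 1))"
  have pos: "norm v + norm w + 1 > 0" by (smt (verit) norm_ge_zero)
  have h: "h > 0" using r pos by (simp add: h_def)
  have half: "r / (2 * q) * q = r / 2" if "q > 0" for q :: real using that by simp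
  have "h * (norm v + norm w) \<le> h * (norm v + norm w + 1)" using h by (simp add: distrib_left)
  also have "\<dots> = r / 2" using half[OF pos] unfolding h_def .
  finally have hr: "h * (norm v + norm w) < r" using r by simp
  have dist: "dist (z + s *\<^sub>R a + t *\<^sub>R b) z < r"
    if "0 < s" "s < h" "0 < t" "t < h" "{a, b} = {v, w}" for s t a b
  proof -
    have "norm (s *\<^sub>R a + t *\<^sub>R b) \<le> s * norm a + t * norm b"
      using norm_triangle_ineq[of "s *\<^sub>R a" "t *\<^sub>R b"] that by simp
    also have "\<dots> \<le> h * norm a + h * norm b"
      by (intro add_mono mult_right_mono) (use that in auto)
    also have "\<dots> = h * (norm v + norm w)"
      using that(5) by (auto simp: distrib_left doubleton_eq_iff)
    finally show ?thesis using hr by (simp add: dist_norm add.assoc)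
  qed
  obtain a b where ab: "0 < a" "a < h" "0 < b" "b < h"
    "f (z + h *\<^sub>R v + h *\<^sub>R w) - f (z + h *\<^sub>R v) - f (z + h *\<^sub>R w) + f z = h * h * ?P v w (z + a *\<^sub>R v + b *\<^sub>R w)"
    using second_difference_mean_value[OF r(2) f h hr] by auto
  have hr': "h * (norm w + norm v) < r" using hr by (simp add: add.commute)
  obtain a' b' where ab': "0 < a'" "a' < h" "0 < b'" "b' < h"
    "f (z + h *\<^sub>R w + h *\<^sub>R v) - f (z + h *\<^sub>R w) - f (z + h *\<^sub>R v) + f z = h * h * ?P w v (z + a' *\<^sub>R w + b' *\<^sub>R v)"
    using second_difference_mean_value[OF r(2) f h hr'] by auto
  have *: "z + h *\<^sub>R w + h *\<^sub>R v = z + h *\<^sub>R v + h *\<^sub>R w" by simp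
  then have "h * h * ?P v w (z + a *\<^sub>R v + b *\<^sub>R w) = h * h * ?P w v (z + a' *\<^sub>R w + b' *\<^sub>R v)"
    using ab(5) ab'(5)[unfolded *] by linarith
  then have "?P v w (z + a *\<^sub>R v + b *\<^sub>R w) = ?P w v (z + a' *\<^sub>R w + b' *\<^sub>R v)"
    using h by simp
  moreover have "\<bar>?P v w (z + a *\<^sub>R v + b *\<^sub>R w) - ?P v w z\<bar> < e"
    using dist[of a b v w] ab by (intro d1(2)) (auto simp: r_def)
  moreover have "\<bar>?P w v (z + a' *\<^sub>R w + b' *\<^sub>R v) - ?P w v z\<bar> < e"
    using dist[of a' b' w v] ab' by (intro d2(2)) (auto simp: r_def)
  ultimately show False unfolding e_def by argo
qed

lemma frechet_derivative_bounded_linear: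
  assumes "bounded_linear L" "f differentiable (at x)"
  shows "frechet_derivative (\<lambda>x. L (f x)) (at x) v = L (frechet_derivative f (at x) v)"
  using assms
  by (subst frechet_derivative_eqI[OF bounded_linear.has_derivative[OF assms(1)]])
     (auto simp: frechet_derivative_works)

lemma second_derivative_symmetric:
  fixes f :: "'a::real_normed_vector \<Rightarrow> complex"
  assumes S: "open S" "z \<in> S" and f: "smooth_on S f"
  shows "frechet_derivative (\<lambda>x. frechet_derivative f (at x) v) (at z) w =
         frechet_derivative (\<lambda>x. frechet_derivative f (at x) w) (at z) v"
proof -
  have "L (frechet_derivative (\<lambda>x. frechet_derivative f (at x) v) (at z) w) =
        L (frechet_derivative (\<lambda>x. frechet_derivative f (at x) w) (at z) v)"
    if L: "bounded_linear L" for L :: "complex \<Rightarrow> real"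
  proof -
    have *: "frechet_derivative (\<lambda>x. frechet_derivative (\<lambda>x. L (f x)) (at x) v) (at z) w =
          L (frechet_derivative (\<lambda>x. frechet_derivative f (at x) v) (at z) w)" for v w
    proof -
      have "frechet_derivative (\<lambda>x. frechet_derivative (\<lambda>x. L (f x)) (at x) v) (at z) w =
            frechet_derivative (\<lambda>x. L (frechet_derivative f (at x) v)) (at z) w"
        using frechet_derivative_bounded_linear[OF L smooth_on_imp_differentiable[OF f]]
        by (subst frechet_derivative_cong_open[OF S]) auto
      also have "\<dots> = L (frechet_derivative (\<lambda>x. frechet_derivative f (at x) v) (at z) w)"
        by (intro frechet_derivative_bounded_linear[OF L]
            smooth_on_imp_differentiable[OF smooth_on_frechet_derivative[OF f]] S)
      finally show ?thesis .
    qed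
    have "C_k_on 2 S (\<lambda>x. L (f x))"
      using smooth_on_bounded_linear[OF S(1) L f] by (simp add: smooth_on_def)
    from second_derivative_symmetric_real[OF S this] show ?thesis by (simp only: *)
  qed
  from this[OF bounded_linear_Re] this[OF bounded_linear_Im] show ?thesis
    by (rule complex_eqI)
qed

section \<open>Wirtinger derivatives\<close>

text \<open>The Wirtinger derivatives of functions of the coordinates. They are what the derivatives
\<^const>\<open>d_z\<close> and \<^const>\<open>d_zbar\<close> of functions on the manifold become after composition with the
inverse of a chart.\<close>

definition Dz :: "'n::finite \<Rightarrow> (complex^'n \<Rightarrow> complex) \<Rightarrow> complex^'n \<Rightarrow> complex" where
  "Dz i F z = (frechet_derivative F (at z) (axis i 1) - \<i> * frechet_derivative F (at z) (axis i \<i>)) / 2"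

definition Dzbar :: "'n::finite \<Rightarrow> (complex^'n \<Rightarrow> complex) \<Rightarrow> complex^'n \<Rightarrow> complex" where
  "Dzbar i F z = (frechet_derivative F (at z) (axis i 1) + \<i> * frechet_derivative F (at z) (axis i \<i>)) / 2"

lemma Dz_cong_open: "open S \<Longrightarrow> z \<in> S \<Longrightarrow> (\<And>y. y \<in> S \<Longrightarrow> F y = G y) \<Longrightarrow> Dz i F z = Dz i G z"
  using frechet_derivative_cong_open[of S z F G] by (simp add: Dz_def)

lemma Dzbar_cong_open: "open S \<Longrightarrow> z \<in> S \<Longrightarrow> (\<And>y. y \<in> S \<Longrightarrow> F y = G y) \<Longrightarrow> Dzbar i F z = Dzbar i G z"
  using frechet_derivative_cong_open[of S z F G] by (simp add: Dzbar_def)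

lemma frechet_derivative_add:
  assumes "F differentiable (at z)" "G differentiable (at z)"
  shows "frechet_derivative (\<lambda>z. F z + G z) (at z) =
    (\<lambda>v. frechet_derivative F (at z) v + frechet_derivative G (at z) v)"
  using assms by (intro frechet_derivative_eqI has_derivative_add) (auto simp: frechet_derivative_works)

lemma frechet_derivative_mult:
  fixes F G :: "'a::real_normed_vector \<Rightarrow> 'b::real_normed_algebra"
  assumes "F differentiable (at z)" "G differentiable (at z)"
  shows "frechet_derivative (\<lambda>z. F z * G z) (at z) =
    (\<lambda>v. F z * frechet_derivative G (at z) v + frechet_derivative F (at z) v * G z)"
  using assms by (intro frechet_derivative_eqI has_derivative_mult) (auto simp: frechet_derivative_works)

lemma Dz_const [simp]: "Dz i (\<lambda>z. c) z = 0" and Dzbar_const [simp]: "Dzbar i (\<lambda>z. c) z = 0"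
  by (simp_all add: Dz_def Dzbar_def)

lemma
  assumes "F differentiable (at z)" "G differentiable (at z)"
  shows Dzbar_add: "Dzbar i (\<lambda>z. F z + G z) z = Dzbar i F z + Dzbar i G z"
    and Dz_mult: "Dz i (\<lambda>z. F z * G z) z = Dz i F z * G z + F z * Dz i G z"
    and Dzbar_mult: "Dzbar i (\<lambda>z. F z * G z) z = Dzbar i F z * G z + F z * Dzbar i G z"
  by (simp_all add: Dz_def Dzbar_def frechet_derivative_add[OF assms]
      frechet_derivative_mult[OF assms] field_simps)

lemma
  assumes "\<And>k. k \<in> I \<Longrightarrow> F k differentiable (at z)"
  shows Dz_sum: "Dz i (\<lambda>z. \<Sum>k\<in>I. F k z) z = (\<Sum>k\<in>I. Dz i (F k) z)"
    and Dzbar_sum: "Dzbar i (\<lambda>z. \<Sum>k\<in>I. F k z) z = (\<Sum>k\<in>I. Dzbar i (F k) z)"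
proof -
  have "frechet_derivative (\<lambda>z. \<Sum>k\<in>I. F k z) (at z) = (\<lambda>v. \<Sum>k\<in>I. frechet_derivative (F k) (at z) v)"
    using assms by (intro frechet_derivative_eqI has_derivative_sum) (auto simp: frechet_derivative_works)
  then show "Dz i (\<lambda>z. \<Sum>k\<in>I. F k z) z = (\<Sum>k\<in>I. Dz i (F k) z)"
    and "Dzbar i (\<lambda>z. \<Sum>k\<in>I. F k z) z = (\<Sum>k\<in>I. Dzbar i (F k) z)"
    by (simp_all add: Dz_def Dzbar_def sum_distrib_left sum_subtractf sum.distrib flip: sum_divide_distrib)
qed

lemma Dz_cnj:
  assumes "F differentiable (at z)"
  shows "Dz i (\<lambda>z. cnj (F z)) z = cnj (Dzbar i F z)"
  by (simp add: Dz_def Dzbar_def frechet_derivative_bounded_linear[OF bounded_linear_cnj assms])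

lemma Dz_exp:
  assumes "F differentiable (at z)"
  shows "Dz i (\<lambda>z. exp (F z)) z = exp (F z) * Dz i F z"
proof -
  have "(F has_derivative frechet_derivative F (at z)) (at z)"
    using assms frechet_derivative_works by blast
  moreover have "(exp has_derivative (*) (exp (F z))) (at (F z))"
    using DERIV_exp[of "F z"] by (simp add: has_field_derivative_def)
  ultimately have "((\<lambda>z. exp (F z)) has_derivative (\<lambda>v. exp (F z) * frechet_derivative F (at z) v)) (at z)"
    by (rule has_derivative_compose)
  then show ?thesis by (simp add: Dz_def frechet_derivative_eqI algebra_simps)
qed

lemma
  assumes "open S" "smooth_on S F"
  shows smooth_on_Dz: "smooth_on S (Dz i F)" and smooth_on_Dzbar: "smooth_on S (Dzbar i F)"
proof -
  have *: "smooth_on S (\<lambda>z. a * frechet_derivative F (at z) v + b * frechet_derivative F (at z) w)" for a b v w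
    using assms by (intro smooth_on_add smooth_on_mult smooth_on_const smooth_on_frechet_derivative)
  show "smooth_on S (Dz i F)"
    using *[of "1/2" "axis i 1" "-\<i>/2" "axis i \<i>"] unfolding Dz_def[abs_def]
    by (simp add: field_simps)
  show "smooth_on S (Dzbar i F)"
    using *[of "1/2" "axis i 1" "\<i>/2" "axis i \<i>"] unfolding Dzbar_def[abs_def]
    by (simp add: field_simps)
qed

text \<open>The symmetry of second derivatives, in the form needed here: to recognise the Laplacian
in the conformal change of the curvature, and to see that derivatives of holomorphic functions are
holomorphic.\<close>

lemma Dz_Dzbar_commute:
  assumes "open S" "z \<in> S" "smooth_on S F"
  shows "Dz i (Dzbar j F) z = Dzbar j (Dz i F) z"
proof -
  let ?D = "\<lambda>v z. frechet_derivative F (at z) v"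
  have d: "?D v differentiable (at z)" for v
    using assms smooth_on_frechet_derivative smooth_on_imp_differentiable by blast
  have D: "((\<lambda>z. ?D v z) has_derivative frechet_derivative (?D v) (at z)) (at z)" for v
    using d frechet_derivative_works by blast
  have bar: "frechet_derivative (Dzbar j F) (at z) =
      (\<lambda>w. (frechet_derivative (?D (axis j 1)) (at z) w + \<i> * frechet_derivative (?D (axis j \<i>)) (at z) w) / 2)"
    unfolding Dzbar_def[abs_def]
    by (rule frechet_derivative_eqI) (auto intro!: derivative_eq_intros D)
  have hol: "frechet_derivative (Dz i F) (at z) =
      (\<lambda>w. (frechet_derivative (?D (axis i 1)) (at z) w - \<i> * frechet_derivative (?D (axis i \<i>)) (at z) w) / 2)"
    unfolding Dz_def[abs_def]
    by (rule frechet_derivative_eqI) (auto intro!: derivative_eq_intros D)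
  show ?thesis
    unfolding Dz_def[of i "Dzbar j F"] Dzbar_def[of j "Dz i F"] bar hol
    using second_derivative_symmetric[OF assms, of "axis i 1"] second_derivative_symmetric[OF assms, of "axis i \<i>"]
    by (simp add: field_simps)
qed

text \<open>A real-linear map splits into a complex-linear and an antilinear part, whose coefficients are the
Wirtinger derivatives. Applied to a derivative at an image point it gives the chain rule.\<close>

lemma real_linear_Wirtinger:
  fixes L :: "complex^'n::finite \<Rightarrow> complex"
  assumes "linear L"
  shows "L w = (\<Sum>k\<in>UNIV. w $ k * ((L (axis k 1) - \<i> * L (axis k \<i>)) / 2)
                          + cnj (w $ k) * ((L (axis k 1) + \<i> * L (axis k \<i>)) / 2))"
proof -
  have "axis k (w $ k) = Re (w $ k) *\<^sub>R axis k 1 + Im (w $ k) *\<^sub>R axis k \<i>" for k :: 'n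
    by (auto simp: vec_eq_iff axis_def complex_eq_iff)
  then have ax: "L (axis k (w $ k)) = Re (w $ k) *\<^sub>R L (axis k 1) + Im (w $ k) *\<^sub>R L (axis k \<i>)" for k
    by (simp add: linear_add[OF assms] linear_scale[OF assms])
  have "w = (\<Sum>k\<in>UNIV. axis k (w $ k))"
    by (auto simp: vec_eq_iff axis_def sum.If_cases if_distrib cong: if_cong)
  then have "L w = (\<Sum>k\<in>UNIV. L (axis k (w $ k)))"
    using linear_sum[OF assms] by metis
  also have "\<dots> = (\<Sum>k\<in>UNIV. w $ k * ((L (axis k 1) - \<i> * L (axis k \<i>)) / 2)
                          + cnj (w $ k) * ((L (axis k 1) + \<i> * L (axis k \<i>)) / 2))"
    unfolding ax by (intro sum.cong refl) (auto simp: complex_eq_iff field_simps)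
  finally show ?thesis .
qed

lemma
  fixes F :: "complex^'n::finite \<Rightarrow> complex^'n" and h :: "complex^'n \<Rightarrow> complex"
  assumes F: "F differentiable (at z)"
    and lin: "\<And>a v. frechet_derivative F (at z) (a *s v) = a *s frechet_derivative F (at z) v"
    and h: "h differentiable (at (F z))"
  shows Dz_compose_holomorphic:
      "Dz i (\<lambda>z. h (F z)) z = (\<Sum>k\<in>UNIV. Dz i (\<lambda>z. F z $ k) z * Dz k h (F z))"
    and Dzbar_compose_holomorphic:
      "Dzbar i (\<lambda>z. h (F z)) z = (\<Sum>k\<in>UNIV. cnj (Dz i (\<lambda>z. F z $ k) z) * Dzbar k h (F z))"
    and Dzbar_holomorphic: "Dzbar i (\<lambda>z. F z $ k) z = 0"
proof -
  let ?F = "frechet_derivative F (at z)" and ?h = "frechet_derivative h (at (F z))"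
  let ?w = "?F (axis i 1)"
  have "axis i \<i> = \<i> *s axis i (1::complex)" by (auto simp: vec_eq_iff axis_def)
  \<comment> \<open>Complex linearity determines the derivative in the imaginary direction by that in the real one.\<close>
  then have w: "?F (axis i \<i>) = \<i> *s ?w" using lin by simp
  have comp: "frechet_derivative (\<lambda>z. F z $ k) (at z) v = ?F v $ k" for k v
    by (rule frechet_derivative_bounded_linear[OF bounded_linear_vec_nth F])
  have J: "Dz i (\<lambda>z. F z $ k) z = ?w $ k" for k
    by (simp add: Dz_def comp w flip: mult.assoc)
  show "Dzbar i (\<lambda>z. F z $ k) z = 0"
    by (simp add: Dzbar_def comp w flip: mult.assoc)
  have chain: "frechet_derivative (\<lambda>z. h (F z)) (at z) = (\<lambda>v. ?h (?F v))"
    using F h by (intro frechet_derivative_eqI has_derivative_compose[where g = h and f = F])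
      (auto simp: frechet_derivative_works)
  have lin_h: "linear ?h" using h linear_frechet_derivative by blast
  note L = real_linear_Wirtinger[OF lin_h, folded Dz_def Dzbar_def]
  have "?h ?w - \<i> * ?h (\<i> *s ?w) = (\<Sum>k\<in>UNIV. 2 * (?w $ k * Dz k h (F z)))"
    unfolding L sum_distrib_left sum_subtractf[symmetric]
    by (intro sum.cong refl) (simp add: algebra_simps)
  then show "Dz i (\<lambda>z. h (F z)) z = (\<Sum>k\<in>UNIV. Dz i (\<lambda>z. F z $ k) z * Dz k h (F z))"
    unfolding Dz_def[of i "\<lambda>z. h (F z)"] chain w J by (simp flip: sum_distrib_left)
  have "?h ?w + \<i> * ?h (\<i> *s ?w) = (\<Sum>k\<in>UNIV. 2 * (cnj (?w $ k) * Dzbar k h (F z)))"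
    unfolding L sum_distrib_left sum.distrib[symmetric]
    by (intro sum.cong refl) (simp add: algebra_simps)
  then show "Dzbar i (\<lambda>z. h (F z)) z = (\<Sum>k\<in>UNIV. cnj (Dz i (\<lambda>z. F z $ k) z) * Dzbar k h (F z))"
    unfolding Dzbar_def[of i "\<lambda>z. h (F z)"] chain w J by (simp flip: sum_distrib_left)
qed

section \<open>Complex matrices\<close>

lemma matrix_inv_eqI:
  fixes A B :: "complex^'n::finite^'n"
  assumes "A ** B = mat 1"
  shows "matrix_inv A = B"
proof -
  have "B ** A = mat 1" using assms matrix_left_right_inverse by blast
  then have "\<exists>A'. A ** A' = mat 1 \<and> A' ** A = mat 1" using assms by blast
  then have *: "A ** matrix_inv A = mat 1 \<and> matrix_inv A ** A = mat 1"
    unfolding matrix_inv_def by (rule someI_ex)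
  then have "matrix_inv A = matrix_inv A ** (A ** B)" using assms by simp
  also have "\<dots> = B" using * by (simp add: matrix_mul_assoc)
  finally show ?thesis .
qed

lemma
  fixes A :: "complex^'n::finite^'n"
  assumes "det A \<noteq> 0"
  shows matrix_inv_right_det: "A ** matrix_inv A = mat 1"
    and matrix_inv_left_det: "matrix_inv A ** A = mat 1"
proof -
  obtain B where "A ** B = mat 1"
    using assms invertible_det_nz invertible_right_inverse by blast
  then show "A ** matrix_inv A = mat 1" "matrix_inv A ** A = mat 1"
    using matrix_inv_eqI matrix_left_right_inverse by metis+
qed

text \<open>Cramer's rule makes the entries of the inverse rational functions of the entries of the matrix,
hence smooth functions of a smooth matrix.\<close>

lemma matrix_inv_cramer:
  fixes A :: "complex^'n::finite^'n"
  assumes "det A \<noteq> 0"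
  shows "matrix_inv A $ k $ l =
    det (\<chi> i j. if j = k then (if i = l then 1 else 0) else A $ i $ j) * inverse (det A)"
proof -
  let ?x = "matrix_inv A *v axis l 1"
  have "A *v ?x = axis l 1"
    by (simp add: matrix_vector_mul_assoc matrix_inv_right_det[OF assms])
  moreover have "?x $ k = matrix_inv A $ k $ l"
    by (simp add: matrix_vector_mult_def axis_def if_distrib cong: if_cong)
  ultimately show ?thesis
    using cramer_lemma[of k A ?x] assms by (simp add: field_simps axis_def cong: if_cong)
qed

lemma smooth_on_det:
  fixes A :: "complex^'m::finite \<Rightarrow> complex^'n::finite^'n"
  assumes "open S" "\<And>i j. smooth_on S (\<lambda>z. A z $ i $ j)"
  shows "smooth_on S (\<lambda>z. det (A z))"
  unfolding det_def using assms
  by (intro smooth_on_sum smooth_on_mult smooth_on_prod smooth_on_const)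

lemma smooth_on_matrix_inv:
  fixes A :: "complex^'m::finite \<Rightarrow> complex^'n::finite^'n"
  assumes "open S" "\<And>i j. smooth_on S (\<lambda>z. A z $ i $ j)" "\<And>z. z \<in> S \<Longrightarrow> det (A z) \<noteq> 0"
  shows "smooth_on S (\<lambda>z. matrix_inv (A z) $ k $ l)"
proof (rule smooth_on_cong[OF assms(1)])
  let ?B = "\<lambda>z. (\<chi> i j. if j = k then (if i = l then 1 else 0) else A z $ i $ j) :: complex^'n^'n"
  have "smooth_on S (\<lambda>z. ?B z $ i $ j)" for i j
    using assms(2) by (cases "j = k") simp_all
  then show "smooth_on S (\<lambda>z. det (?B z) * inverse (det (A z)))"
    using assms by (intro smooth_on_mult smooth_on_inverse smooth_on_det)
qed (simp add: matrix_inv_cramer assms(3))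

lemma hermitian_pos_def_det_nonzero:
  assumes "hermitian_pos_def G"
  shows "det G \<noteq> 0"
proof
  assume "det G = 0"
  then have "\<not> (\<exists>B. B ** G = mat 1)"
    using invertible_det_nz invertible_left_inverse by blast
  then obtain x where x: "x \<noteq> 0" "G *v x = 0"
    by (auto simp: matrix_left_invertible_ker)
  let ?v = "\<chi> i. cnj (x $ i)"
  have "(\<Sum>i\<in>UNIV. \<Sum>j\<in>UNIV. G $ i $ j * ?v $ i * cnj (?v $ j)) = (\<Sum>i\<in>UNIV. ?v $ i * (G *v x) $ i)"
    by (simp add: matrix_vector_mult_def sum_distrib_left mult_ac)
  also have "\<dots> = 0" using x by simp
  finally have "\<not> 0 < Re (\<Sum>i\<in>UNIV. \<Sum>j\<in>UNIV. G $ i $ j * ?v $ i * cnj (?v $ j))" by simp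
  moreover have "?v \<noteq> 0" using x(1) by (auto simp: vec_eq_iff)
  ultimately show False using assms unfolding hermitian_pos_def_def by blast
qed

lemma hermitian_det_real:
  assumes "\<And>i j. G $ j $ i = cnj (G $ i $ j)"
  shows "Im (det (G :: complex^'n::finite^'n)) = 0"
proof -
  have "cnj (det G) = det (transpose G)"
    unfolding det_def transpose_def by (simp add: assms[symmetric])
  then have "cnj (det G) = det G" by simp
  then show ?thesis by (simp add: complex_eq_iff)
qed

text \<open>The segment from the identity matrix to \<open>G\<close> consists of positive definite Hermitian matrices. Their
determinants are real and nonzero, so along the segment the sign cannot change from that of
\<open>det 1 = 1\<close>. The lemma makes the volume density positive.\<close>

lemma hermitian_pos_def_det_pos:
  fixes G :: "complex^'n::finite^'n"
  assumes G: "hermitian_pos_def G"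
  shows "Re (det G) > 0"
proof (rule ccontr)
  assume neg: "\<not> Re (det G) > 0"
  define P :: "real \<Rightarrow> complex^'n^'n" where "P t = (1 - t) *\<^sub>R mat 1 + t *\<^sub>R G" for t
  have herm: "P t $ j $ i = cnj (P t $ i $ j)" for t i j
  proof -
    have "G $ j $ i = cnj (G $ i $ j)" using G unfolding hermitian_pos_def_def by blast
    then show ?thesis by (simp add: P_def mat_def)
  qed
  have pos: "hermitian_pos_def (P t)" if t: "0 \<le> t" "t \<le> 1" for t
    unfolding hermitian_pos_def_def
  proof (intro conjI allI impI herm)
    fix v :: "complex^'n" assume v: "v \<noteq> 0"
    let ?Q = "\<lambda>H::complex^'n^'n. Re (\<Sum>i\<in>UNIV. \<Sum>j\<in>UNIV. H $ i $ j * v $ i * cnj (v $ j))"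
    have convex: "(1 - t) * a + t * b > 0" if "a > 0" "b > 0" for a b :: real
      using t that by (cases "t = 1") (auto intro!: add_pos_nonneg)
    have Q: "?Q (P t) = (1 - t) * ?Q (mat 1) + t * ?Q G"
      by (simp add: P_def sum.distrib sum_distrib_left scaleR_sum_right ring_distribs mult.assoc)
    have "(\<Sum>i\<in>UNIV. \<Sum>j\<in>UNIV. (mat 1 :: complex^'n^'n) $ i $ j * v $ i * cnj (v $ j))
        = (\<Sum>i\<in>UNIV. v $ i * cnj (v $ i))"
      by (simp add: mat_def if_distrib[of "\<lambda>c. c * _"] cong: if_cong)
    then have Q1: "?Q (mat 1) = (\<Sum>i\<in>UNIV. (cmod (v $ i))\<^sup>2)"
      by (simp only: complex_norm_square[symmetric]) simp
    have "?Q (mat 1) > 0" unfolding Q1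
    proof -
      obtain i where "v $ i \<noteq> 0" using v by (auto simp: vec_eq_iff)
      then show "(\<Sum>i\<in>UNIV. (cmod (v $ i))\<^sup>2) > 0" by (intro sum_pos2[of _ i]) auto
    qed
    moreover have "?Q G > 0" using G v unfolding hermitian_pos_def_def by blast
    ultimately show "?Q (P t) > 0" unfolding Q by (rule convex)
  qed
  have cont: "continuous_on {0..1} (\<lambda>t. Re (det (P t)))"
    unfolding det_def P_def by (auto intro!: continuous_intros)
  have "Re (det (P 0)) > 0" "Re (det (P 1)) \<le> 0" using neg by (auto simp: P_def)
  then obtain t where t: "0 \<le> t" "t \<le> 1" "Re (det (P t)) = 0"
    using IVT2'[of "\<lambda>t. Re (det (P t))" 1 0 0] cont by (meson less_imp_le zero_le_one)
  moreover have "Im (det (P t)) = 0" using herm by (rule hermitian_det_real)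
  ultimately have "det (P t) = 0" by (simp add: complex_eq_iff)
  then show False using hermitian_pos_def_det_nonzero[OF pos[OF t(1,2)]] by contradiction
qed

section \<open>Chern scalar curvature and Laplacian in coordinates\<close>

text \<open>The trace of the connection matrix, \<open>tr (G\<inverse> \<partial>\<^sub>i G) = \<partial>\<^sub>i log det G\<close>. The scalar curvature depends
on the connection only through it. Working with the trace instead of the logarithm avoids
differentiating determinants.\<close>

definition chern_trace :: "(complex^'n::finite \<Rightarrow> complex^'n^'n) \<Rightarrow> 'n \<Rightarrow> complex^'n \<Rightarrow> complex" where
  "chern_trace G i z =
     (\<Sum>k\<in>UNIV. \<Sum>q\<in>UNIV. matrix_inv (G z) $ q $ k * Dz i (\<lambda>z. G z $ k $ q) z)"

text \<open>The scalar curvature \<open>- g\<^bsup>ij\<^esup> \<partial>\<^sub>j-bar tr (G\<inverse> \<partial>\<^sub>i G)\<close>, that is, the trace of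
\<open>-\<i>\<partial>\<partial>-bar log det G\<close>. The double contraction of the curvature tensor reduces to this form in
\<open>chern_scalar_contraction\<close>.\<close>

definition coord_scalar :: "(complex^'n::finite \<Rightarrow> complex^'n^'n) \<Rightarrow> complex^'n \<Rightarrow> complex" where
  "coord_scalar G z = - (\<Sum>i\<in>UNIV. \<Sum>j\<in>UNIV. matrix_inv (G z) $ j $ i * Dzbar j (chern_trace G i) z)"

definition coord_laplacian ::
    "(complex^'n::finite \<Rightarrow> complex^'n^'n) \<Rightarrow> (complex^'n \<Rightarrow> complex) \<Rightarrow> complex^'n \<Rightarrow> complex" where
  "coord_laplacian G \<phi> z = (\<Sum>i\<in>UNIV. \<Sum>j\<in>UNIV. matrix_inv (G z) $ j $ i * Dz i (Dzbar j \<phi>) z)"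

lemma trace_matrix_mult_explicit:
  "trace ((A :: complex^'n::finite^'n) ** B) = (\<Sum>k\<in>UNIV. \<Sum>q\<in>UNIV. A $ q $ k * B $ k $ q)"
  unfolding trace_def matrix_matrix_mult_def by (subst sum.swap) simp

lemma smooth_on_chern_trace:
  assumes "open S" "\<And>i j. smooth_on S (\<lambda>z. G z $ i $ j)" "\<And>z. z \<in> S \<Longrightarrow> det (G z) \<noteq> 0"
  shows "smooth_on S (chern_trace G i)"
  unfolding chern_trace_def[abs_def] using assms
  by (intro smooth_on_sum smooth_on_mult smooth_on_matrix_inv smooth_on_Dz)

lemma continuous_on_coord_scalar:
  assumes "open S" "\<And>i j. smooth_on S (\<lambda>z. G z $ i $ j)" "\<And>z. z \<in> S \<Longrightarrow> det (G z) \<noteq> 0"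
  shows "continuous_on S (coord_scalar G)"
  unfolding coord_scalar_def[abs_def] using assms
  by (intro continuous_on_minus continuous_on_sum continuous_on_mult smooth_on_imp_continuous_on
      smooth_on_matrix_inv smooth_on_Dzbar smooth_on_chern_trace)

lemma continuous_on_coord_laplacian:
  assumes "open S" "\<And>i j. smooth_on S (\<lambda>z. G z $ i $ j)" "\<And>z. z \<in> S \<Longrightarrow> det (G z) \<noteq> 0"
    and "smooth_on S \<phi>"
  shows "continuous_on S (coord_laplacian G \<phi>)"
  unfolding coord_laplacian_def[abs_def] using assms
  by (intro continuous_on_sum continuous_on_mult smooth_on_imp_continuous_on
      smooth_on_matrix_inv smooth_on_Dz smooth_on_Dzbar)

lemma coord_laplacian_scale:
  assumes "open S" "z \<in> S" "smooth_on S \<phi>"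
  shows "coord_laplacian G (\<lambda>z. c * \<phi> z) z = c * coord_laplacian G \<phi> z"
proof -
  have bar: "Dzbar j (\<lambda>z. c * \<phi> z) y = c * Dzbar j \<phi> y" if "y \<in> S" for j y
    using smooth_on_imp_differentiable[OF assms(3) that] by (simp add: Dzbar_mult)
  have "Dz i (Dzbar j (\<lambda>z. c * \<phi> z)) z = c * Dz i (Dzbar j \<phi>) z" for i j
  proof -
    have "Dz i (Dzbar j (\<lambda>z. c * \<phi> z)) z = Dz i (\<lambda>z. c * Dzbar j \<phi> z) z"
      by (rule Dz_cong_open[OF assms(1,2) bar])
    also have "\<dots> = c * Dz i (Dzbar j \<phi>) z"
      using smooth_on_imp_differentiable[OF smooth_on_Dzbar[OF assms(1,3)] assms(2)]
      by (simp add: Dz_mult)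
    finally show ?thesis .
  qed
  then show ?thesis by (simp add: coord_laplacian_def sum_distrib_left mult_ac)
qed

lemma matrix_inv_scale:
  fixes B :: "complex^'n::finite^'n"
  assumes "det B \<noteq> 0"
  shows "matrix_inv (exp r *\<^sub>R B) = exp (- r) *\<^sub>R matrix_inv B"
proof (rule matrix_inv_eqI)
  have "(exp r *\<^sub>R B) ** (exp (- r) *\<^sub>R matrix_inv B) = (exp r * exp (- r)) *\<^sub>R (B ** matrix_inv B)"
    by (simp add: matrix_matrix_mult_def vec_eq_iff scaleR_sum_right mult_ac)
  then show "(exp r *\<^sub>R B) ** (exp (- r) *\<^sub>R matrix_inv B) = mat 1"
    by (simp add: matrix_inv_right_det[OF assms] flip: exp_add)
qed

text \<open>Since \<open>G' = e\<^sup>u G\<close> gives \<open>G'\<inverse> \<partial>\<^sub>i G' = (\<partial>\<^sub>i u) 1 + G\<inverse> \<partial>\<^sub>i G\<close>, taking traces adds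
\<open>n \<partial>\<^sub>i u\<close>.\<close>

lemma chern_trace_conformal:
  fixes G :: "complex^'n::finite \<Rightarrow> complex^'n^'n" and u :: "complex^'n \<Rightarrow> real"
  assumes "open S" "z \<in> S" "\<And>i j. smooth_on S (\<lambda>z. G z $ i $ j)" "det (G z) \<noteq> 0"
    and u: "smooth_on S (\<lambda>z. complex_of_real (u z))"
  shows "chern_trace (\<lambda>z. exp (u z) *\<^sub>R G z) i z =
    of_nat CARD('n) * Dz i (\<lambda>z. complex_of_real (u z)) z + chern_trace G i z"
proof -
  let ?u = "\<lambda>z. complex_of_real (u z)" and ?I = "matrix_inv (G z)"
  have diff: "?u differentiable (at z)" "(\<lambda>z. G z $ k $ q) differentiable (at z)"
    "(\<lambda>z. exp (?u z)) differentiable (at z)" for k q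
    using assms by (auto intro: smooth_on_imp_differentiable smooth_on_exp)
  have entry: "(exp (u y) *\<^sub>R G y) $ k $ q = exp (?u y) * G y $ k $ q" for y k q
    by (simp only: vector_scaleR_component) (simp add: scaleR_conv_of_real exp_of_real)
  have "matrix_inv (exp (u z) *\<^sub>R G z) $ q $ k * Dz i (\<lambda>z. (exp (u z) *\<^sub>R G z) $ k $ q) z =
     ?I $ q $ k * G z $ k $ q * Dz i ?u z + ?I $ q $ k * Dz i (\<lambda>z. G z $ k $ q) z" for k q
  proof -
    have "Dz i (\<lambda>z. (exp (u z) *\<^sub>R G z) $ k $ q) z =
        exp (?u z) * (Dz i ?u z * G z $ k $ q + Dz i (\<lambda>z. G z $ k $ q) z)"
      unfolding entry by (simp add: Dz_mult Dz_exp diff algebra_simps)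
    moreover have "matrix_inv (exp (u z) *\<^sub>R G z) $ q $ k = exp (- ?u z) * ?I $ q $ k"
      by (simp only: matrix_inv_scale[OF assms(4)] vector_scaleR_component)
        (simp add: scaleR_conv_of_real exp_of_real[symmetric])
    ultimately show ?thesis by (simp only:) (simp add: exp_minus field_simps)
  qed
  then have "chern_trace (\<lambda>z. exp (u z) *\<^sub>R G z) i z =
      (\<Sum>k\<in>UNIV. \<Sum>q\<in>UNIV. ?I $ q $ k * G z $ k $ q) * Dz i ?u z + chern_trace G i z"
    unfolding chern_trace_def by (simp add: sum.distrib sum_distrib_right)
  also have "(\<Sum>k\<in>UNIV. \<Sum>q\<in>UNIV. ?I $ q $ k * G z $ k $ q) = trace (?I ** G z)"
    by (simp add: trace_matrix_mult_explicit)
  also have "\<dots> = of_nat CARD('n)"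
    by (simp add: matrix_inv_left_det[OF assms(4)] trace_I)
  finally show ?thesis .
qed

lemma coord_scalar_conformal:
  fixes G :: "complex^'n::finite \<Rightarrow> complex^'n^'n" and u :: "complex^'n \<Rightarrow> real"
  assumes S: "open S" "z \<in> S"
    and G: "\<And>i j. smooth_on S (\<lambda>z. G z $ i $ j)" "\<And>z. z \<in> S \<Longrightarrow> det (G z) \<noteq> 0"
    and u: "smooth_on S (\<lambda>z. complex_of_real (u z))"
  shows "coord_scalar (\<lambda>z. exp (u z) *\<^sub>R G z) z =
    exp (- u z) *\<^sub>R (coord_scalar G z - of_nat CARD('n) * coord_laplacian G (\<lambda>z. complex_of_real (u z)) z)"
proof -
  let ?u = "\<lambda>z. complex_of_real (u z)" and ?I = "matrix_inv (G z)" and ?n = "of_nat CARD('n) :: complex"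
  have "Dzbar j (chern_trace (\<lambda>z. exp (u z) *\<^sub>R G z) i) z =
      ?n * Dz i (Dzbar j ?u) z + Dzbar j (chern_trace G i) z" for i j
  proof -
    have "Dz i ?u differentiable (at z)" "chern_trace G i differentiable (at z)"
      using S G u smooth_on_Dz smooth_on_chern_trace smooth_on_imp_differentiable by metis+
    moreover have "Dzbar j (chern_trace (\<lambda>z. exp (u z) *\<^sub>R G z) i) z =
        Dzbar j (\<lambda>z. ?n * Dz i ?u z + chern_trace G i z) z"
      using chern_trace_conformal[OF S(1) _ G(1) G(2) u] by (intro Dzbar_cong_open[OF S]) auto
    ultimately show ?thesis
      by (simp add: Dzbar_add Dzbar_mult Dz_Dzbar_commute[OF S u])
  qed
  moreover have "matrix_inv (exp (u z) *\<^sub>R G z) $ j $ i = of_real (exp (- u z)) * ?I $ j $ i" for i j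
    unfolding matrix_inv_scale[OF G(2)[OF S(2)]] vector_scaleR_component
    by (simp only: scaleR_conv_of_real)
  ultimately show ?thesis
    unfolding coord_scalar_def coord_laplacian_def scaleR_conv_of_real
    by (simp add: sum.distrib sum_distrib_left algebra_simps)
qed

section \<open>Independence of the holomorphic coordinates\<close>

text \<open>The function \<^const>\<open>chern_scalar\<close> uses at each point an arbitrarily chosen chart, and likewise
\<^const>\<open>complex_laplacian\<close>. Only the invariance under holomorphic changes of coordinates shows
that they are continuous functions. With the Jacobian matrix \<open>J\<close> of the change \<open>F\<close>, the metric
transforms by \<open>G = J (H \<circ> F) J\<^sup>*\<close>.\<close>

locale holomorphic_coordinate_change =
  fixes U V :: "(complex^'n::finite) set" and F :: "complex^'n \<Rightarrow> complex^'n"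
    and G H :: "complex^'n \<Rightarrow> complex^'n^'n"
  assumes U: "open U" and V: "open V" and F: "holomorphic_map_on U F" and FUV: "F ` U \<subseteq> V"
    and G: "\<And>i j. smooth_on U (\<lambda>z. G z $ i $ j)" "\<And>z. z \<in> U \<Longrightarrow> det (G z) \<noteq> 0"
    and H: "\<And>i j. smooth_on V (\<lambda>z. H z $ i $ j)" "\<And>z. z \<in> V \<Longrightarrow> det (H z) \<noteq> 0"
    and pullback: "\<And>z i j. z \<in> U \<Longrightarrow> G z $ i $ j = (\<Sum>k\<in>UNIV. \<Sum>l\<in>UNIV.
        Dz i (\<lambda>z. F z $ k) z * cnj (Dz j (\<lambda>z. F z $ l) z) * H (F z) $ k $ l)"
begin

definition jac :: "complex^'n \<Rightarrow> complex^'n^'n" where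
  "jac z = (\<chi> i k. Dz i (\<lambda>z. F z $ k) z)"

definition jac_adj :: "complex^'n \<Rightarrow> complex^'n^'n" where
  "jac_adj z = (\<chi> l j. cnj (Dz j (\<lambda>z. F z $ l) z))"

lemma F_diff: "z \<in> U \<Longrightarrow> F differentiable (at z)"
  using F smooth_on_imp_differentiable unfolding holomorphic_map_on_def by blast

lemma F_lin: "z \<in> U \<Longrightarrow> frechet_derivative F (at z) (a *s v) = a *s frechet_derivative F (at z) v"
  using F unfolding holomorphic_map_on_def by blast

lemma smooth_F: "smooth_on U (\<lambda>z. F z $ k)"
  using F smooth_on_bounded_linear[OF U bounded_linear_vec_nth] unfolding holomorphic_map_on_def by blast

lemma smooth_jac: "smooth_on U (\<lambda>z. jac z $ i $ k)"
  unfolding jac_def by (simp add: smooth_on_Dz[OF U smooth_F])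

lemma Dzbar_F: "z \<in> U \<Longrightarrow> Dzbar j (\<lambda>z. F z $ k) z = 0"
  by (rule Dzbar_holomorphic[where h = "\<lambda>_. 0"]) (auto intro: F_diff F_lin)

text \<open>The Jacobian of a holomorphic map is holomorphic: \<open>\<partial>\<^sub>j-bar\<close> commutes with \<open>\<partial>\<^sub>i\<close>, and \<open>\<partial>\<^sub>j-bar F = 0\<close>.\<close>

lemma Dzbar_jac: "z \<in> U \<Longrightarrow> Dzbar j (\<lambda>z. jac z $ i $ k) z = 0"
proof -
  assume z: "z \<in> U"
  have "Dzbar j (\<lambda>z. jac z $ i $ k) z = Dz i (Dzbar j (\<lambda>z. F z $ k)) z"
    unfolding jac_def by (simp add: Dz_Dzbar_commute[OF U z smooth_F])
  also have "\<dots> = Dz i (\<lambda>z. 0) z"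
    by (rule Dz_cong_open[OF U z Dzbar_F])
  finally show ?thesis by simp
qed

lemma G_eq: "z \<in> U \<Longrightarrow> G z = jac z ** (H (F z) ** jac_adj z)"
  by (simp add: vec_eq_iff pullback matrix_matrix_mult_def jac_def jac_adj_def sum_distrib_left mult_ac)

lemma dets: assumes "z \<in> U" shows "det (jac z) \<noteq> 0" "det (jac_adj z) \<noteq> 0" "det (H (F z)) \<noteq> 0"
  using G(2)[OF assms] unfolding G_eq[OF assms] det_mul by auto

lemma inv_G: assumes "z \<in> U"
  shows "matrix_inv (G z) = matrix_inv (jac_adj z) ** (matrix_inv (H (F z)) ** matrix_inv (jac z))"
proof (rule matrix_inv_eqI)
  have "jac z ** (H (F z) ** jac_adj z) ** (matrix_inv (jac_adj z) ** (matrix_inv (H (F z)) ** matrix_inv (jac z)))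
    = jac z ** (H (F z) ** (jac_adj z ** matrix_inv (jac_adj z)) ** matrix_inv (H (F z))) ** matrix_inv (jac z)"
    by (simp only: matrix_mul_assoc)
  then show "G z ** (matrix_inv (jac_adj z) ** (matrix_inv (H (F z)) ** matrix_inv (jac z))) = mat 1"
    by (simp add: G_eq[OF assms] matrix_inv_right_det dets[OF assms])
qed

text \<open>Tensors of type (1,1) have an invariant trace, because \<open>J\<^sup>* G\<inverse> J = (H \<circ> F)\<inverse>\<close>.\<close>

lemma contraction: assumes "z \<in> U"
  shows "(\<Sum>i\<in>UNIV. \<Sum>j\<in>UNIV. matrix_inv (G z) $ j $ i *
      (\<Sum>k\<in>UNIV. \<Sum>l\<in>UNIV. jac z $ i $ k * cnj (jac z $ j $ l) * t k l)) =
    (\<Sum>k\<in>UNIV. \<Sum>l\<in>UNIV. matrix_inv (H (F z)) $ l $ k * t k l)"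
proof -
  have "jac_adj z ** matrix_inv (G z) ** jac z =
    (jac_adj z ** matrix_inv (jac_adj z)) ** matrix_inv (H (F z)) ** (matrix_inv (jac z) ** jac z)"
    unfolding inv_G[OF assms] by (simp only: matrix_mul_assoc)
  also have "\<dots> = matrix_inv (H (F z))"
    by (simp add: matrix_inv_right_det matrix_inv_left_det dets[OF assms])
  finally have *: "matrix_inv (H (F z)) = jac_adj z ** matrix_inv (G z) ** jac z" ..
  have adj: "jac_adj z $ l $ j = cnj (jac z $ j $ l)" for l j
    by (simp add: jac_def jac_adj_def)
  let ?T = "\<lambda>i j k l. matrix_inv (G z) $ j $ i * (jac z $ i $ k * cnj (jac z $ j $ l) * t k l)"
  have "(\<Sum>i\<in>UNIV. \<Sum>j\<in>UNIV. matrix_inv (G z) $ j $ i *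
      (\<Sum>k\<in>UNIV. \<Sum>l\<in>UNIV. jac z $ i $ k * cnj (jac z $ j $ l) * t k l)) =
      (\<Sum>i\<in>UNIV. \<Sum>j\<in>UNIV. \<Sum>k\<in>UNIV. \<Sum>l\<in>UNIV. ?T i j k l)"
    by (simp add: sum_distrib_left)
  also have "\<dots> = (\<Sum>i\<in>UNIV. \<Sum>k\<in>UNIV. \<Sum>j\<in>UNIV. \<Sum>l\<in>UNIV. ?T i j k l)"
    by (intro sum.cong refl sum.swap)
  also have "\<dots> = (\<Sum>k\<in>UNIV. \<Sum>i\<in>UNIV. \<Sum>l\<in>UNIV. \<Sum>j\<in>UNIV. ?T i j k l)"
    by (subst sum.swap) (intro sum.cong refl sum.swap)
  also have "\<dots> = (\<Sum>k\<in>UNIV. \<Sum>l\<in>UNIV. \<Sum>i\<in>UNIV. \<Sum>j\<in>UNIV. ?T i j k l)"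
    by (intro sum.cong refl sum.swap)
  also have "\<dots> = (\<Sum>k\<in>UNIV. \<Sum>l\<in>UNIV. matrix_inv (H (F z)) $ l $ k * t k l)"
    unfolding * by (simp add: matrix_matrix_mult_def adj sum_distrib_left sum_distrib_right mult_ac)
  finally show ?thesis .
qed

lemma compose_diff:
  "z \<in> U \<Longrightarrow> smooth_on V h \<Longrightarrow> (\<lambda>z. h (F z)) differentiable (at z)"
  using differentiable_chain_at[OF F_diff, of z h] smooth_on_imp_differentiable FUV
  by (auto simp: o_def image_subset_iff)

lemma
  assumes z: "z \<in> U" and h: "smooth_on V (h :: complex^'n \<Rightarrow> complex)"
  shows Dz_compose: "Dz i (\<lambda>z. h (F z)) z = (\<Sum>k\<in>UNIV. jac z $ i $ k * Dz k h (F z))"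
    and Dzbar_compose: "Dzbar i (\<lambda>z. h (F z)) z = (\<Sum>k\<in>UNIV. cnj (jac z $ i $ k) * Dzbar k h (F z))"
proof -
  have "h differentiable (at (F z))" using smooth_on_imp_differentiable[OF h] FUV z by auto
  from Dz_compose_holomorphic[OF F_diff[OF z] F_lin[OF z] this]
    Dzbar_compose_holomorphic[OF F_diff[OF z] F_lin[OF z] this]
  show "Dz i (\<lambda>z. h (F z)) z = (\<Sum>k\<in>UNIV. jac z $ i $ k * Dz k h (F z))"
    "Dzbar i (\<lambda>z. h (F z)) z = (\<Sum>k\<in>UNIV. cnj (jac z $ i $ k) * Dzbar k h (F z))"
    by (simp_all add: jac_def)
qed

lemma jac_diff: "z \<in> U \<Longrightarrow> (\<lambda>z. jac z $ i $ k) differentiable (at z)"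
  using smooth_jac smooth_on_imp_differentiable by blast

lemma cnj_jac_diff: "z \<in> U \<Longrightarrow> (\<lambda>z. cnj (jac z $ i $ k)) differentiable (at z)"
  using smooth_on_bounded_linear[OF U bounded_linear_cnj smooth_jac] smooth_on_imp_differentiable by blast

text \<open>The complex Hessian is a tensor: in the second differentiation the factor \<open>cnj J\<close> is constant for
\<open>\<partial>\<^sub>i\<close> since \<open>J\<close> is holomorphic, so no first-order term of \<open>\<phi>\<close> appears.\<close>

lemma coord_laplacian_invariant:
  assumes z: "z \<in> U" and \<phi>: "smooth_on V \<phi>"
  shows "coord_laplacian G (\<lambda>z. \<phi> (F z)) z = coord_laplacian H \<phi> (F z)"
proof -
  have "Dz i (Dzbar j (\<lambda>z. \<phi> (F z))) z =
      (\<Sum>k\<in>UNIV. \<Sum>l\<in>UNIV. jac z $ i $ k * cnj (jac z $ j $ l) * Dz k (Dzbar l \<phi>) (F z))" for i j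
  proof -
    have d: "(\<lambda>z. Dzbar l \<phi> (F z)) differentiable (at z)" for l
      by (rule compose_diff[OF z smooth_on_Dzbar[OF V \<phi>]])
    have "Dz i (Dzbar j (\<lambda>z. \<phi> (F z))) z = Dz i (\<lambda>z. \<Sum>l\<in>UNIV. cnj (jac z $ j $ l) * Dzbar l \<phi> (F z)) z"
      by (rule Dz_cong_open[OF U z]) (rule Dzbar_compose[OF _ \<phi>])
    also have "\<dots> = (\<Sum>l\<in>UNIV. Dz i (\<lambda>z. cnj (jac z $ j $ l) * Dzbar l \<phi> (F z)) z)"
      by (intro Dz_sum differentiable_mult cnj_jac_diff[OF z] d)
    also have "\<dots> = (\<Sum>l\<in>UNIV. \<Sum>k\<in>UNIV. jac z $ i $ k * cnj (jac z $ j $ l) * Dz k (Dzbar l \<phi>) (F z))"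
      by (simp only: Dz_mult[OF cnj_jac_diff[OF z] d] Dz_cnj[OF jac_diff[OF z]] Dzbar_jac[OF z]
          Dz_compose[OF z smooth_on_Dzbar[OF V \<phi>]]) (simp add: sum_distrib_left mult_ac)
    finally show ?thesis by (subst sum.swap)
  qed
  then show ?thesis unfolding coord_laplacian_def by (simp add: contraction[OF z])
qed

text \<open>Differentiating \<open>J\<inverse> J = 1\<close> gives \<open>(\<partial>\<^sub>j-bar J\<inverse>) J = 0\<close>.\<close>

lemma Dzbar_inv_jac: assumes z: "z \<in> U" shows "Dzbar j (\<lambda>z. matrix_inv (jac z) $ a $ k) z = 0"
proof -
  have d: "(\<lambda>z. matrix_inv (jac z) $ a $ k) differentiable (at z)" for a k
    by (rule smooth_on_imp_differentiable[OF smooth_on_matrix_inv[OF U smooth_jac dets(1)] z])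
  define X :: "complex^'n^'n" where "X = (\<chi> a k. Dzbar j (\<lambda>z. matrix_inv (jac z) $ a $ k) z)"
  have "(X ** jac z) $ a $ l = 0" for a l
  proof -
    have "(X ** jac z) $ a $ l = (\<Sum>k\<in>UNIV. Dzbar j (\<lambda>z. matrix_inv (jac z) $ a $ k * jac z $ k $ l) z)"
      by (simp add: X_def matrix_matrix_mult_def Dzbar_mult[OF d jac_diff[OF z]] Dzbar_jac[OF z])
    also have "\<dots> = Dzbar j (\<lambda>z. \<Sum>k\<in>UNIV. matrix_inv (jac z) $ a $ k * jac z $ k $ l) z"
      by (intro Dzbar_sum[symmetric] differentiable_mult d jac_diff[OF z])
    also have "\<dots> = Dzbar j (\<lambda>z. mat 1 $ a $ l) z"
    proof (rule Dzbar_cong_open[OF U z])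
      fix y assume "y \<in> U"
      then have "matrix_inv (jac y) ** jac y = mat 1" by (simp add: matrix_inv_left_det dets)
      then show "(\<Sum>k\<in>UNIV. matrix_inv (jac y) $ a $ k * jac y $ k $ l) = mat 1 $ a $ l"
        by (simp add: matrix_matrix_mult_def vec_eq_iff)
    qed
    finally show ?thesis by simp
  qed
  then have "X ** jac z = 0" by (simp add: vec_eq_iff)
  then have "X ** (jac z ** matrix_inv (jac z)) = 0"
    by (simp add: matrix_mul_assoc)
  then have "X = 0" by (simp add: matrix_inv_right_det dets[OF z])
  then show ?thesis by (simp add: X_def vec_eq_iff)
qed

text \<open>Differentiating \<open>G = J (H \<circ> F) J\<^sup>*\<close> by \<open>\<partial>\<^sub>i\<close> leaves \<open>J\<^sup>*\<close> alone, and cyclic invariance of the trace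
gives \<open>tr (G\<inverse> \<partial>\<^sub>i G) = tr (J\<inverse> \<partial>\<^sub>i J) + tr ((H \<circ> F)\<inverse> \<partial>\<^sub>i (H \<circ> F))\<close>. The inhomogeneous first term
is holomorphic.\<close>

lemma chern_trace_change:
  assumes z: "z \<in> U"
  shows "chern_trace G i z =
    (\<Sum>k\<in>UNIV. \<Sum>a\<in>UNIV. matrix_inv (jac z) $ a $ k * Dz i (\<lambda>z. jac z $ k $ a) z) +
    (\<Sum>k\<in>UNIV. jac z $ i $ k * chern_trace H k (F z))"
proof -
  define dJ :: "complex^'n^'n" where "dJ = (\<chi> k a. Dz i (\<lambda>z. jac z $ k $ a) z)"
  define dH :: "complex^'n^'n" where "dH = (\<chi> a b. Dz i (\<lambda>z. H (F z) $ a $ b) z)"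
  define dG :: "complex^'n^'n" where "dG = (\<chi> k q. Dz i (\<lambda>z. G z $ k $ q) z)"
  let ?J = "jac z" and ?A = "jac_adj z" and ?H = "H (F z)"
  have Hd: "(\<lambda>z. H (F z) $ a $ b) differentiable (at z)" for a b
    by (rule compose_diff[OF z H(1)])
  have adj: "jac_adj y $ b $ q = cnj (jac y $ q $ b)" for y b q
    by (simp add: jac_def jac_adj_def)
  have dA: "Dz i (\<lambda>z. cnj (jac z $ q $ b)) z = 0" for q b
    by (simp add: Dz_cnj[OF jac_diff[OF z]] Dzbar_jac[OF z])
  have "dG $ k $ q = (dJ ** (?H ** ?A) + ?J ** (dH ** ?A)) $ k $ q" for k q
  proof -
    have "dG $ k $ q = Dz i (\<lambda>z. \<Sum>a\<in>UNIV. jac z $ k $ a * (\<Sum>b\<in>UNIV. H (F z) $ a $ b * cnj (jac z $ q $ b))) z"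
      unfolding dG_def
      by simp (rule Dz_cong_open[OF U z], simp add: G_eq matrix_matrix_mult_def adj)
    also have "\<dots> = (\<Sum>a\<in>UNIV. Dz i (\<lambda>z. jac z $ k $ a) z * (\<Sum>b\<in>UNIV. ?H $ a $ b * cnj (?J $ q $ b)) +
         ?J $ k $ a * (\<Sum>b\<in>UNIV. Dz i (\<lambda>z. H (F z) $ a $ b) z * cnj (?J $ q $ b)))"
      by (simp add: Dz_sum Dz_mult differentiable_mult differentiable_sum jac_diff[OF z] Hd cnj_jac_diff[OF z] dA)
    also have "\<dots> = (dJ ** (?H ** ?A) + ?J ** (dH ** ?A)) $ k $ q"
      by (simp add: matrix_matrix_mult_def dJ_def dH_def adj sum.distrib)
    finally show ?thesis .
  qed
  then have dG: "dG = dJ ** (?H ** ?A) + ?J ** (dH ** ?A)" by (simp add: vec_eq_iff)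
  let ?iJ = "matrix_inv ?J" and ?iA = "matrix_inv ?A" and ?iH = "matrix_inv ?H"
  have "chern_trace G i z = trace (matrix_inv (G z) ** dG)"
    by (simp add: chern_trace_def trace_matrix_mult_explicit dG_def)
  also have "matrix_inv (G z) ** dG = ?iA ** (?iH ** ?iJ ** dJ ** ?H ** ?A) + ?iA ** (?iH ** (?iJ ** ?J) ** dH ** ?A)"
    unfolding inv_G[OF z] dG by (simp only: matrix_add_ldistrib matrix_mul_assoc)
  also have "trace \<dots> = trace (?iH ** ?iJ ** dJ ** ?H ** ?A ** ?iA) + trace (?iH ** (?iJ ** ?J) ** dH ** ?A ** ?iA)"
    by (simp only: trace_add trace_mul_sym[of ?iA])
  also have "\<dots> = trace (?iH ** (?iJ ** dJ ** ?H) ** (?A ** ?iA)) + trace (?iH ** (?iJ ** ?J) ** dH ** (?A ** ?iA))"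
    by (simp only: matrix_mul_assoc)
  also have "\<dots> = trace (?iH ** (?iJ ** dJ ** ?H)) + trace (?iH ** dH)"
    by (simp add: matrix_inv_right_det matrix_inv_left_det dets[OF z])
  also have "trace (?iH ** (?iJ ** dJ ** ?H)) = trace ((?iJ ** dJ ** ?H) ** ?iH)"
    by (rule trace_mul_sym)
  also have "\<dots> = trace (?iJ ** dJ ** (?H ** ?iH))"
    by (simp only: matrix_mul_assoc)
  also have "\<dots> = trace (?iJ ** dJ)"
    by (simp add: matrix_inv_right_det dets[OF z])
  also have "trace (?iJ ** dJ) = (\<Sum>k\<in>UNIV. \<Sum>a\<in>UNIV. matrix_inv (jac z) $ a $ k * Dz i (\<lambda>z. jac z $ k $ a) z)"
    by (simp add: trace_matrix_mult_explicit dJ_def)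
  also have "trace (?iH ** dH) =
      (\<Sum>a\<in>UNIV. \<Sum>b\<in>UNIV. ?iH $ b $ a * (\<Sum>k\<in>UNIV. ?J $ i $ k * Dz k (\<lambda>z. H z $ a $ b) (F z)))"
    by (simp add: trace_matrix_mult_explicit dH_def Dz_compose[OF z H(1)])
  also have "\<dots> = (\<Sum>a\<in>UNIV. \<Sum>b\<in>UNIV. \<Sum>k\<in>UNIV. ?J $ i $ k * (?iH $ b $ a * Dz k (\<lambda>z. H z $ a $ b) (F z)))"
    by (simp add: sum_distrib_left mult_ac)
  also have "\<dots> = (\<Sum>a\<in>UNIV. \<Sum>k\<in>UNIV. \<Sum>b\<in>UNIV. ?J $ i $ k * (?iH $ b $ a * Dz k (\<lambda>z. H z $ a $ b) (F z)))"
    by (intro sum.cong refl sum.swap)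
  also have "\<dots> = (\<Sum>k\<in>UNIV. jac z $ i $ k * chern_trace H k (F z))"
    by (subst sum.swap) (simp add: chern_trace_def sum_distrib_left)
  finally show ?thesis .
qed

text \<open>The inhomogeneous term of \<open>chern_trace_change\<close> is killed by \<open>\<partial>\<^sub>j-bar\<close>, so that what remains
transforms as a tensor of type (1,1).\<close>

lemma coord_scalar_invariant:
  assumes z: "z \<in> U"
  shows "coord_scalar G z = coord_scalar H (F z)"
proof -
  have "Dzbar j (chern_trace G i) z =
      (\<Sum>k\<in>UNIV. \<Sum>l\<in>UNIV. jac z $ i $ k * cnj (jac z $ j $ l) * Dzbar l (chern_trace H k) (F z))" for i j
  proof -
    let ?h1 = "\<lambda>z. \<Sum>k\<in>UNIV. \<Sum>a\<in>UNIV. matrix_inv (jac z) $ a $ k * Dz i (\<lambda>z. jac z $ k $ a) z"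
    let ?h2 = "\<lambda>z. \<Sum>k\<in>UNIV. jac z $ i $ k * chern_trace H k (F z)"
    have d1: "(\<lambda>z. matrix_inv (jac z) $ a $ k) differentiable (at z)" for a k
      by (rule smooth_on_imp_differentiable[OF smooth_on_matrix_inv[OF U smooth_jac dets(1)] z])
    have d2: "Dz i (\<lambda>z. jac z $ k $ a) differentiable (at z)" for a k
      by (rule smooth_on_imp_differentiable[OF smooth_on_Dz[OF U smooth_jac] z])
    have sT: "smooth_on V (chern_trace H k)" for k by (rule smooth_on_chern_trace[OF V H])
    have d3: "(\<lambda>z. chern_trace H k (F z)) differentiable (at z)" for k
      by (rule compose_diff[OF z sT])
    have "Dzbar j (Dz i (\<lambda>z. jac z $ k $ a)) z = Dz i (\<lambda>_. 0) z" for k a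
      unfolding Dz_Dzbar_commute[OF U z smooth_jac, symmetric]
      by (rule Dz_cong_open[OF U z Dzbar_jac])
    then have h1: "Dzbar j ?h1 z = 0"
      by (simp add: Dzbar_sum Dzbar_mult differentiable_sum differentiable_mult d1 d2 Dzbar_inv_jac[OF z])
    have h2: "Dzbar j ?h2 z = (\<Sum>k\<in>UNIV. \<Sum>l\<in>UNIV. jac z $ i $ k * cnj (jac z $ j $ l) * Dzbar l (chern_trace H k) (F z))"
      by (simp add: Dzbar_sum Dzbar_mult differentiable_mult jac_diff[OF z] d3 Dzbar_jac[OF z]
          Dzbar_compose[OF z sT] sum_distrib_left mult_ac)
    have "Dzbar j (chern_trace G i) z = Dzbar j (\<lambda>z. ?h1 z + ?h2 z) z"
      by (rule Dzbar_cong_open[OF U z]) (rule chern_trace_change)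
    also have "\<dots> = Dzbar j ?h1 z + Dzbar j ?h2 z"
      by (intro Dzbar_add differentiable_sum finite differentiable_mult d1 d2 d3 jac_diff[OF z] ballI)
    finally show ?thesis by (simp only: h1 h2 add_0)
  qed
  then show ?thesis unfolding coord_scalar_def by (simp add: contraction[OF z])
qed

end

section \<open>The Chern scalar curvature and the Laplacian on the manifold\<close>

lemma
  assumes "complex_chart M c"
  shows chart_inv_map: "x \<in> chart_dom c \<Longrightarrow> chart_inv c (chart_map c x) = x"
    and open_chart_image: "open (chart_image c)"
    and chart_dom_topspace: "chart_dom c \<subseteq> topspace M"
proof -
  have "openin M (chart_dom c)" using assms by (simp add: complex_chart_def)
  then show sub: "chart_dom c \<subseteq> topspace M" by (rule openin_subset)
  show "open (chart_image c)" using assms by (simp add: complex_chart_def)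
  have "inj_on (chart_map c) (topspace (subtopology M (chart_dom c)))"
    using assms homeomorphic_imp_injective_map unfolding complex_chart_def by blast
  then have "inj_on (chart_map c) (chart_dom c)" using sub by (simp add: inf_absorb2)
  then show "x \<in> chart_dom c \<Longrightarrow> chart_inv c (chart_map c x) = x"
    by (simp add: chart_inv_def)
qed

lemma chart_map_inv: "z \<in> chart_image c \<Longrightarrow> chart_map c (chart_inv c z) = z"
  by (simp add: chart_image_def chart_inv_def f_inv_into_f)

lemma chart_inv_in_dom: "z \<in> chart_image c \<Longrightarrow> chart_inv c z \<in> chart_dom c"
  by (simp add: chart_image_def chart_inv_def inv_into_into)

lemma chart_map_in_image: "x \<in> chart_dom c \<Longrightarrow> chart_map c x \<in> chart_image c"
  by (simp add: chart_image_def)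

lemma open_chart_map_image:
  assumes c: "complex_chart M c" and W: "openin M W" "W \<subseteq> chart_dom c"
  shows "open (chart_map c ` W)"
proof -
  have "openin (subtopology M (chart_dom c)) W"
    using c W by (simp add: complex_chart_def openin_open_subtopology)
  then have "openin (top_of_set (chart_image c)) (chart_map c ` W)"
    using c homeomorphic_map_openness_eq unfolding complex_chart_def by blast
  then show ?thesis using open_chart_image[OF c] by (simp add: openin_open_eq)
qed

lemma continuous_map_chart_map:
  "complex_chart M c \<Longrightarrow> continuous_map (subtopology M (chart_dom c)) euclidean (chart_map c)"
  unfolding complex_chart_def
  using homeomorphic_imp_continuous_map continuous_map_in_subtopology by blast

lemma continuous_on_chart_inv:
  assumes c: "complex_chart M c" and h: "continuous_map M euclidean h"
  shows "continuous_on (chart_image c) (\<lambda>z. h (chart_inv c z))"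
proof -
  obtain k where k: "homeomorphic_maps (subtopology M (chart_dom c)) (top_of_set (chart_image c)) (chart_map c) k"
    using c homeomorphic_map_maps unfolding complex_chart_def by blast
  have "continuous_map (top_of_set (chart_image c)) M k"
    using k by (auto simp: homeomorphic_maps_def continuous_map_in_subtopology)
  then have "continuous_map (top_of_set (chart_image c)) euclidean (h \<circ> k)"
    using h continuous_map_compose by blast
  moreover have "k z = chart_inv c z" if "z \<in> chart_image c" for z
  proof -
    have "chart_map c (chart_inv c z) = z" "chart_inv c z \<in> chart_dom c"
      using that chart_map_inv chart_inv_in_dom by metis+
    then show ?thesis using k chart_dom_topspace[OF c]
      unfolding homeomorphic_maps_def by (metis IntI subsetD topspace_subtopology)
  qed
  ultimately show ?thesis
    by (auto simp: o_def cong: continuous_on_cong)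
qed

lemma d_z_eq_Dz: "d_z c i f x = Dz i (\<lambda>z. f (chart_inv c z)) (chart_map c x)"
  by (simp add: d_z_def Dz_def Let_def o_def)

lemma d_zbar_eq_Dzbar: "d_zbar c i f x = Dzbar i (\<lambda>z. f (chart_inv c z)) (chart_map c x)"
  by (simp add: d_zbar_def Dzbar_def Let_def o_def)

definition local_metric :: "('a, 'n::finite) metric \<Rightarrow> ('a, 'n) chart \<Rightarrow> complex^'n \<Rightarrow> complex^'n^'n" where
  "local_metric g c z = g c (chart_inv c z)"

locale hermitian_manifold =
  fixes M :: "'a topology" and A :: "('a, 'n::finite) chart set" and g :: "('a, 'n) metric"
  assumes manifold: "complex_manifold M A" and metric: "hermitian_metric A g"
begin

lemma chart: "c \<in> A \<Longrightarrow> complex_chart M c"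
  using manifold by (simp add: complex_manifold_def)

lemma smooth_local_metric: "c \<in> A \<Longrightarrow> smooth_on (chart_image c) (\<lambda>z. local_metric g c z $ i $ j)"
  using metric by (simp add: hermitian_metric_def smooth_in_chart_def o_def local_metric_def)

lemma pos_def: "c \<in> A \<Longrightarrow> x \<in> chart_dom c \<Longrightarrow> hermitian_pos_def (g c x)"
  using metric unfolding hermitian_metric_def by blast

lemma det_local_metric: "c \<in> A \<Longrightarrow> z \<in> chart_image c \<Longrightarrow> det (local_metric g c z) \<noteq> 0"
  by (simp add: local_metric_def hermitian_pos_def_det_nonzero pos_def chart_inv_in_dom)

lemma chart_at: "x \<in> topspace M \<Longrightarrow> chart_at A x \<in> A \<and> x \<in> chart_dom (chart_at A x)"
  unfolding chart_at_def
  by (rule someI_ex) (use manifold in \<open>auto simp: complex_manifold_def\<close>)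

text \<open>Contracting \<open>g\<^bsup>kl\<^esup>\<close> with the factor \<open>g\<^bsub>ml\<^esub>\<close> of the curvature tensor sets \<open>m = k\<close> and leaves the
\<open>\<partial>\<close>-bar derivative of the trace of the connection matrix.\<close>

lemma chern_scalar_contraction:
  assumes c: "c \<in> A" and x: "x \<in> chart_dom c"
  shows "(\<Sum>i\<in>UNIV. \<Sum>j\<in>UNIV. \<Sum>k\<in>UNIV. \<Sum>l\<in>UNIV.
       g_upper g c i j x * g_upper g c k l x * chern_curvature g c i j k l x) =
    coord_scalar (local_metric g c) (chart_map c x)"
proof -
  let ?S = "chart_image c" and ?G = "local_metric g c"
  define \<Gamma> where "\<Gamma> l i k z = (\<Sum>q\<in>UNIV. matrix_inv (?G z) $ q $ l * Dz i (\<lambda>z. ?G z $ k $ q) z)" for l i k z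
  note S = open_chart_image[OF chart[OF c]]
  define z where "z = chart_map c x"
  have z: "z \<in> ?S" "chart_inv c z = x"
    using chart_map_in_image[OF x] chart_inv_map[OF chart[OF c] x] by (simp_all add: z_def)
  let ?I = "matrix_inv (g c x)"
  have \<Gamma>: "chern_Gamma g c l i k (chart_inv c y) = \<Gamma> l i k y" if "y \<in> ?S" for l i k y
    using that by (simp add: chern_Gamma_def \<Gamma>_def g_upper_def d_z_eq_Dz local_metric_def chart_map_inv)
  have \<Gamma>_smooth: "smooth_on ?S (\<Gamma> l i k)" for l i k
    unfolding \<Gamma>_def[abs_def] using S c
    by (intro smooth_on_sum smooth_on_mult smooth_on_matrix_inv smooth_on_Dz smooth_local_metric det_local_metric)
  have d\<Gamma>: "d_zbar c j (chern_Gamma g c m i k) x = Dzbar j (\<Gamma> m i k) z" for j m i k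
    unfolding d_zbar_eq_Dzbar z_def[symmetric] by (rule Dzbar_cong_open[OF S z(1) \<Gamma>])
  have "(\<Sum>k\<in>UNIV. \<Sum>l\<in>UNIV. g_upper g c i j x * g_upper g c k l x * chern_curvature g c i j k l x)
      = - (?I $ j $ i * Dzbar j (chern_trace ?G i) z)" for i j
  proof -
    let ?d = "\<lambda>m k. Dzbar j (\<Gamma> m i k) z"
    have inv: "(\<Sum>l\<in>UNIV. g c x $ m $ l * ?I $ l $ k) = (if m = k then 1 else 0)" for m k
    proof -
      have "(g c x ** ?I) $ m $ k = mat 1 $ m $ k"
        using matrix_inv_right_det[OF hermitian_pos_def_det_nonzero[OF pos_def[OF c x]]] by simp
      then show ?thesis by (simp add: matrix_matrix_mult_def mat_def)
    qed
    have "(\<Sum>k\<in>UNIV. \<Sum>l\<in>UNIV. g_upper g c i j x * g_upper g c k l x * chern_curvature g c i j k l x)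
      = (\<Sum>k\<in>UNIV. \<Sum>l\<in>UNIV. \<Sum>m\<in>UNIV. - (?I $ j $ i * (g c x $ m $ l * ?I $ l $ k) * ?d m k))"
      unfolding g_upper_def chern_curvature_def d\<Gamma>
      by (simp add: sum_distrib_left mult_ac sum_negf)
    also have "\<dots> = (\<Sum>k\<in>UNIV. \<Sum>m\<in>UNIV. \<Sum>l\<in>UNIV. - (?I $ j $ i * (g c x $ m $ l * ?I $ l $ k) * ?d m k))"
      by (intro sum.cong refl sum.swap)
    also have "\<dots> = (\<Sum>k\<in>UNIV. \<Sum>m\<in>UNIV. - (?I $ j $ i * (\<Sum>l\<in>UNIV. g c x $ m $ l * ?I $ l $ k) * ?d m k))"
      by (simp only: sum_distrib_left sum_distrib_right sum_negf)
    also have "\<dots> = (\<Sum>k\<in>UNIV. - (?I $ j $ i * ?d k k))"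
      unfolding inv by (simp add: if_distrib[of "\<lambda>a. _ * a"] if_distrib[of "\<lambda>a. a * _"] if_distrib[of uminus] cong: if_cong)
    also have "\<dots> = - (?I $ j $ i * (\<Sum>k\<in>UNIV. ?d k k))"
      by (simp add: sum_distrib_left sum_negf)
    also have "(\<Sum>k\<in>UNIV. ?d k k) = Dzbar j (\<lambda>z. \<Sum>k\<in>UNIV. \<Gamma> k i k z) z"
      by (rule Dzbar_sum[symmetric]) (rule smooth_on_imp_differentiable[OF \<Gamma>_smooth z(1)])
    also have "(\<lambda>z. \<Sum>k\<in>UNIV. \<Gamma> k i k z) = chern_trace ?G i"
      by (simp add: fun_eq_iff \<Gamma>_def chern_trace_def)
    finally show ?thesis .
  qed
  then show ?thesis
    unfolding coord_scalar_def z_def[symmetric] by (simp add: local_metric_def z(2) sum_negf)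
qed

text \<open>In the coordinates of \<open>c\<close>, with the transition map from \<open>c\<close> to \<open>d\<close>, the compatibility of the
metric components is exactly the pullback condition of \<^locale>\<open>holomorphic_coordinate_change\<close>.\<close>

lemma coordinate_change:
  assumes c: "c \<in> A" and d: "d \<in> A"
  shows "holomorphic_coordinate_change (chart_map c ` (chart_dom c \<inter> chart_dom d)) (chart_image d)
    (\<lambda>z. chart_map d (chart_inv c z)) (local_metric g c) (local_metric g d)"
proof
  let ?U = "chart_map c ` (chart_dom c \<inter> chart_dom d)"
  have sub: "?U \<subseteq> chart_image c" by (auto simp: chart_image_def)
  have inv: "chart_inv c z \<in> chart_dom c \<inter> chart_dom d" if "z \<in> ?U" for z
    using that chart_inv_map[OF chart[OF c]] by auto
  show "open ?U"
    using chart[OF c] chart[OF d] open_chart_map_image[OF chart[OF c]]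
    by (simp add: complex_chart_def openin_Int)
  show "open (chart_image d)" by (rule open_chart_image[OF chart[OF d]])
  show "holomorphic_map_on ?U (\<lambda>z. chart_map d (chart_inv c z))"
    using manifold c d by (simp add: complex_manifold_def o_def)
  show "(\<lambda>z. chart_map d (chart_inv c z)) ` ?U \<subseteq> chart_image d"
    using inv by (intro image_subsetI chart_map_in_image) blast
  show "smooth_on ?U (\<lambda>z. local_metric g c z $ i $ j)" for i j
    using smooth_local_metric[OF c] sub by (rule smooth_on_subset)
  show "det (local_metric g c z) \<noteq> 0" if "z \<in> ?U" for z
    using det_local_metric[OF c] sub that by blast
  show "smooth_on (chart_image d) (\<lambda>z. local_metric g d z $ i $ j)" for i j
    by (rule smooth_local_metric[OF d])
  show "det (local_metric g d z) \<noteq> 0" if "z \<in> chart_image d" for z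
    by (rule det_local_metric[OF d that])
  fix z i j assume z: "z \<in> ?U"
  have dd: "chart_inv d (chart_map d (chart_inv c z)) = chart_inv c z"
    using inv[OF z] chart_inv_map[OF chart[OF d]] by blast
  have cc: "chart_map c (chart_inv c z) = z" using z sub chart_map_inv by blast
  have "g c (chart_inv c z) $ i $ j = (\<Sum>k\<in>UNIV. \<Sum>l\<in>UNIV.
          d_z c i (\<lambda>y. chart_map d y $ k) (chart_inv c z) * cnj (d_z c j (\<lambda>y. chart_map d y $ l) (chart_inv c z))
          * g d (chart_inv c z) $ k $ l)"
    using metric inv[OF z] c d unfolding hermitian_metric_def by blast
  then show "local_metric g c z $ i $ j = (\<Sum>k\<in>UNIV. \<Sum>l\<in>UNIV.
      Dz i (\<lambda>z. chart_map d (chart_inv c z) $ k) z * cnj (Dz j (\<lambda>z. chart_map d (chart_inv c z) $ l) z) *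
      local_metric g d (chart_map d (chart_inv c z)) $ k $ l)"
    by (simp add: local_metric_def d_z_eq_Dz dd cc)
qed

lemma chern_scalar_chart:
  assumes c: "c \<in> A" and x: "x \<in> chart_dom c"
  shows "chern_scalar A g x = Re (coord_scalar (local_metric g c) (chart_map c x))"
proof -
  define d where "d = chart_at A x"
  have "x \<in> topspace M" using chart_dom_topspace[OF chart[OF c]] x by blast
  then have d: "d \<in> A" "x \<in> chart_dom d" using chart_at by (auto simp: d_def)
  interpret holomorphic_coordinate_change "chart_map c ` (chart_dom c \<inter> chart_dom d)" "chart_image d"
    "\<lambda>z. chart_map d (chart_inv c z)" "local_metric g c" "local_metric g d"
    by (rule coordinate_change[OF c d(1)])
  have "coord_scalar (local_metric g c) (chart_map c x) = coord_scalar (local_metric g d) (chart_map d x)"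
    using coord_scalar_invariant[of "chart_map c x"] x d chart_inv_map[OF chart[OF c] x] by auto
  then show ?thesis
    unfolding chern_scalar_def Let_def d_def[symmetric] chern_scalar_contraction[OF d] by simp
qed

lemma smooth_complex:
  "c \<in> A \<Longrightarrow> smooth_function A f \<Longrightarrow> smooth_on (chart_image c) (\<lambda>z. complex_of_real (f (chart_inv c z)))"
  by (rule smooth_on_bounded_linear[OF open_chart_image[OF chart] bounded_linear_of_real])
    (auto simp: smooth_function_def smooth_in_chart_def o_def)

lemma laplacian_contraction:
  assumes c: "c \<in> A" and x: "x \<in> chart_dom c" and f: "smooth_function A f"
  shows "(\<Sum>i\<in>UNIV. \<Sum>j\<in>UNIV.
       g_upper g c i j x * d_z c i (d_zbar c j (\<lambda>y. complex_of_real (f y))) x) =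
    coord_laplacian (local_metric g c) (\<lambda>z. complex_of_real (f (chart_inv c z))) (chart_map c x)"
proof -
  let ?f = "\<lambda>z. complex_of_real (f (chart_inv c z))"
  have "d_z c i (d_zbar c j (\<lambda>y. complex_of_real (f y))) x = Dz i (Dzbar j ?f) (chart_map c x)" for i j
    unfolding d_z_eq_Dz d_zbar_eq_Dzbar
    by (rule Dz_cong_open[OF open_chart_image[OF chart[OF c]] chart_map_in_image[OF x]])
      (simp add: chart_map_inv)
  then show ?thesis
    by (simp add: coord_laplacian_def g_upper_def local_metric_def chart_inv_map[OF chart[OF c] x])
qed

lemma complex_laplacian_chart:
  assumes c: "c \<in> A" and x: "x \<in> chart_dom c" and f: "smooth_function A f"
  shows "complex_laplacian A g f x =
    Re (coord_laplacian (local_metric g c) (\<lambda>z. complex_of_real (f (chart_inv c z))) (chart_map c x))"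
proof -
  define d where "d = chart_at A x"
  have "x \<in> topspace M" using chart_dom_topspace[OF chart[OF c]] x by blast
  then have d: "d \<in> A" "x \<in> chart_dom d" using chart_at by (auto simp: d_def)
  let ?U = "chart_map c ` (chart_dom c \<inter> chart_dom d)"
  let ?f = "\<lambda>c z. complex_of_real (f (chart_inv c z))"
  interpret holomorphic_coordinate_change ?U "chart_image d"
    "\<lambda>z. chart_map d (chart_inv c z)" "local_metric g c" "local_metric g d"
    by (rule coordinate_change[OF c d(1)])
  have z: "chart_map c x \<in> ?U" using x d by blast
  have "coord_laplacian (local_metric g c) (?f c) (chart_map c x) =
      coord_laplacian (local_metric g c) (\<lambda>z. ?f d (chart_map d (chart_inv c z))) (chart_map c x)"
  proof -
    have "?f c y = ?f d (chart_map d (chart_inv c y))" if "y \<in> ?U" for y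
      using that chart_inv_map[OF chart[OF c]] chart_inv_map[OF chart[OF d(1)]] by auto
    then have "Dzbar j (?f c) y = Dzbar j (\<lambda>z. ?f d (chart_map d (chart_inv c z))) y" if "y \<in> ?U" for y j
      using that by (intro Dzbar_cong_open[OF U]) auto
    then have "Dz i (Dzbar j (?f c)) (chart_map c x) =
        Dz i (Dzbar j (\<lambda>z. ?f d (chart_map d (chart_inv c z)))) (chart_map c x)" for i j
      by (rule Dz_cong_open[OF U z])
    then show ?thesis by (simp add: coord_laplacian_def)
  qed
  also have "\<dots> = coord_laplacian (local_metric g d) (?f d) (chart_map d x)"
    using coord_laplacian_invariant[OF z smooth_complex[OF d(1) f]] chart_inv_map[OF chart[OF c] x] by simp
  finally show ?thesis
    unfolding complex_laplacian_def Let_def d_def[symmetric] laplacian_contraction[OF d f] by simp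
qed

lemma continuous_on_chern_scalar:
  assumes c: "c \<in> A"
  shows "continuous_on (chart_image c) (\<lambda>z. chern_scalar A g (chart_inv c z))"
proof -
  have "continuous_on (chart_image c) (\<lambda>z. Re (coord_scalar (local_metric g c) z))"
    using open_chart_image[OF chart[OF c]] c
    by (intro continuous_on_Re continuous_on_coord_scalar smooth_local_metric det_local_metric)
  then show ?thesis
    by (simp add: chern_scalar_chart[OF c] chart_inv_in_dom chart_map_inv cong: continuous_on_cong)
qed

lemma continuous_on_complex_laplacian:
  assumes c: "c \<in> A" and f: "smooth_function A f"
  shows "continuous_on (chart_image c) (\<lambda>z. complex_laplacian A g f (chart_inv c z))"
proof -
  have "continuous_on (chart_image c)
      (\<lambda>z. Re (coord_laplacian (local_metric g c) (\<lambda>z. complex_of_real (f (chart_inv c z))) z))"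
    using open_chart_image[OF chart[OF c]] c f
    by (intro continuous_on_Re continuous_on_coord_laplacian smooth_local_metric det_local_metric smooth_complex)
  then show ?thesis
    by (simp add: complex_laplacian_chart[OF c _ f] chart_inv_in_dom chart_map_inv cong: continuous_on_cong)
qed

lemma continuous_on_smooth_function:
  "c \<in> A \<Longrightarrow> smooth_function A f \<Longrightarrow> continuous_on (chart_image c) (\<lambda>z. f (chart_inv c z))"
  by (auto simp: smooth_function_def smooth_in_chart_def o_def dest: smooth_on_imp_continuous_on)

lemma continuous_on_vol_density:
  assumes c: "c \<in> A"
  shows "continuous_on (chart_image c) (\<lambda>z. vol_density g c (chart_inv c z))"
  using smooth_on_imp_continuous_on[OF smooth_on_det[OF open_chart_image[OF chart[OF c]] smooth_local_metric[OF c]]]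
  by (simp add: vol_density_def local_metric_def continuous_on_mult continuous_on_Re)

lemma vol_density_pos: "c \<in> A \<Longrightarrow> x \<in> chart_dom c \<Longrightarrow> vol_density g c x > 0"
  by (simp add: vol_density_def hermitian_pos_def_det_pos pos_def)

text \<open>The formulas in charts thereby apply to the conformal metric as well, which gives its curvature on
the manifold.\<close>

lemma hermitian_conformal_metric:
  assumes u: "smooth_function A u"
  shows "hermitian_metric A (conformal_metric u g)"
  unfolding hermitian_metric_def
proof (intro conjI ballI allI)
  fix c i j assume c: "c \<in> A"
  have "smooth_on (chart_image c) (\<lambda>z. exp (complex_of_real (u (chart_inv c z))) * local_metric g c z $ i $ j)"
    using open_chart_image[OF chart[OF c]] c u
    by (intro smooth_on_mult smooth_on_exp smooth_complex smooth_local_metric)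
  moreover have "((\<lambda>x. conformal_metric u g c x $ i $ j) \<circ> chart_inv c) =
     (\<lambda>z. exp (complex_of_real (u (chart_inv c z))) * local_metric g c z $ i $ j)"
    by (auto simp: fun_eq_iff conformal_metric_def local_metric_def exp_of_real scaleR_conv_of_real[where 'a = complex])
  ultimately show "smooth_in_chart c (\<lambda>x. conformal_metric u g c x $ i $ j)"
    by (simp add: smooth_in_chart_def)
next
  fix c x assume c: "c \<in> A" and x: "x \<in> chart_dom c"
  show "hermitian_pos_def (conformal_metric u g c x)"
    unfolding hermitian_pos_def_def
  proof (intro conjI allI impI)
    have sym: "g c x $ j $ i = cnj (g c x $ i $ j)" for i j
      using pos_def[OF c x] unfolding hermitian_pos_def_def by blast
    show "conformal_metric u g c x $ j $ i = cnj (conformal_metric u g c x $ i $ j)" for i j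
      by (simp add: conformal_metric_def sym[of i j])
    fix v :: "complex^'n" assume "v \<noteq> 0"
    then have "0 < Re (\<Sum>i\<in>UNIV. \<Sum>j\<in>UNIV. g c x $ i $ j * v $ i * cnj (v $ j))"
      using pos_def[OF c x] unfolding hermitian_pos_def_def by blast
    moreover have "(\<Sum>i\<in>UNIV. \<Sum>j\<in>UNIV. conformal_metric u g c x $ i $ j * v $ i * cnj (v $ j)) =
        exp (u x) *\<^sub>R (\<Sum>i\<in>UNIV. \<Sum>j\<in>UNIV. g c x $ i $ j * v $ i * cnj (v $ j))"
      by (simp add: conformal_metric_def scaleR_sum_right)
    ultimately show "0 < Re (\<Sum>i\<in>UNIV. \<Sum>j\<in>UNIV. conformal_metric u g c x $ i $ j * v $ i * cnj (v $ j))"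
      by simp
  qed
next
  fix c d x i j assume cd: "c \<in> A" "d \<in> A" "x \<in> chart_dom c \<inter> chart_dom d"
  then have "g c x $ i $ j = (\<Sum>k\<in>UNIV. \<Sum>l\<in>UNIV.
          d_z c i (\<lambda>y. chart_map d y $ k) x * cnj (d_z c j (\<lambda>y. chart_map d y $ l) x) * g d x $ k $ l)"
    using metric unfolding hermitian_metric_def by blast
  then show "conformal_metric u g c x $ i $ j = (\<Sum>k\<in>UNIV. \<Sum>l\<in>UNIV.
          d_z c i (\<lambda>y. chart_map d y $ k) x * cnj (d_z c j (\<lambda>y. chart_map d y $ l) x)
          * conformal_metric u g d x $ k $ l)"
    by (simp add: conformal_metric_def scaleR_sum_right)
qed

lemma chern_scalar_conformal:
  assumes u: "smooth_function A u" and x: "x \<in> topspace M"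
  shows "chern_scalar A (conformal_metric u g) x =
    exp (- u x) * (chern_scalar A g x - real CARD('n) * complex_laplacian A g u x)"
proof -
  define c where "c = chart_at A x"
  have c: "c \<in> A" "x \<in> chart_dom c" using chart_at[OF x] by (auto simp: c_def)
  interpret conf: hermitian_manifold M A "conformal_metric u g"
    using manifold hermitian_conformal_metric[OF u] by unfold_locales
  have loc: "local_metric (conformal_metric u g) c = (\<lambda>z. exp (u (chart_inv c z)) *\<^sub>R local_metric g c z)"
    by (simp add: fun_eq_iff local_metric_def conformal_metric_def)
  have "coord_scalar (local_metric (conformal_metric u g) c) (chart_map c x) =
     exp (- u x) *\<^sub>R (coord_scalar (local_metric g c) (chart_map c x) - of_nat CARD('n) *
       coord_laplacian (local_metric g c) (\<lambda>z. complex_of_real (u (chart_inv c z))) (chart_map c x))"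
    unfolding loc
    using coord_scalar_conformal[OF open_chart_image[OF chart[OF c(1)]] chart_map_in_image[OF c(2)]
        smooth_local_metric[OF c(1)] det_local_metric[OF c(1)] smooth_complex[OF c(1) u]]
      chart_inv_map[OF chart[OF c(1)] c(2)] by simp
  then show ?thesis
    by (simp add: chern_scalar_chart[OF c] conf.chern_scalar_chart[OF c] complex_laplacian_chart[OF c u])
qed

lemma smooth_function_scale:
  "smooth_function A f \<Longrightarrow> smooth_function A (\<lambda>x. t * f x)"
  unfolding smooth_function_def smooth_in_chart_def o_def
  using smooth_on_mult[OF open_chart_image[OF chart] smooth_on_const] by blast

lemma complex_laplacian_scale:
  assumes f: "smooth_function A f" and x: "x \<in> topspace M"
  shows "complex_laplacian A g (\<lambda>x. t * f x) x = t * complex_laplacian A g f x"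
proof -
  define c where "c = chart_at A x"
  have c: "c \<in> A" "x \<in> chart_dom c" using chart_at[OF x] by (auto simp: c_def)
  show ?thesis
    using coord_laplacian_scale[OF open_chart_image[OF chart[OF c(1)]] chart_map_in_image[OF c(2)]
        smooth_complex[OF c(1) f], of "local_metric g c" "complex_of_real t"]
    by (simp add: complex_laplacian_chart[OF c f] complex_laplacian_chart[OF c smooth_function_scale[OF f]])
qed

end

lemma vol_density_conformal:
  fixes g :: "('a, 'n::finite) metric"
  shows "vol_density (conformal_metric u g) c x = exp (real CARD('n) * u x) * vol_density g c x"
proof -
  have "det (r *\<^sub>R B) = of_real r ^ CARD('n) * det B" for r and B :: "complex^'n^'n"
    by (simp add: det_def sum_distrib_left scaleR_conv_of_real[where 'a = complex] prod.distrib mult_ac)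
  then have "det (exp (u x) *\<^sub>R g c x) = of_real (exp (u x) ^ CARD('n)) * det (g c x)" by simp
  also have "exp (u x) ^ CARD('n) = exp (real CARD('n) * u x)" by (rule exp_of_nat_mult[symmetric])
  finally show ?thesis by (simp add: vol_density_def conformal_metric_def)
qed

section \<open>Partitions of unity\<close>

text \<open>A compact Hausdorff space is completely regular, so around each point there is a bump function
supported in a chart. Finitely many of them have no common zero; dividing by their sum and
collecting those with the same chart gives the partition.\<close>

lemma compact_manifold_partition_of_unity:
  assumes M: "complex_manifold M A" and compact: "compact_space M"
  shows "\<exists>I \<rho>. partition_of_unity M A I \<rho>"
proof -
  have "Hausdorff_space M" using M by (simp add: complex_manifold_def)
  then have creg: "completely_regular_space M"
    using compact compact_Hausdorff_or_regular_imp_normal_space normal_imp_completely_regular_space by blast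
  define bump_at where "bump_at x c \<psi> \<longleftrightarrow> c \<in> A \<and> continuous_map M euclideanreal \<psi> \<and> (\<forall>y. 0 \<le> \<psi> y) \<and>
      M closure_of {y \<in> topspace M. \<psi> y \<noteq> 0} \<subseteq> chart_dom c \<and> \<psi> x > 0" for x c and \<psi> :: "'a \<Rightarrow> real"
  have "\<exists>c \<psi>. bump_at x c \<psi>" if x: "x \<in> topspace M" for x
  proof -
    obtain c where c: "c \<in> A" "x \<in> chart_dom c" using M x by (auto simp: complex_manifold_def)
    then have "openin M (chart_dom c)" using M by (simp add: complex_manifold_def complex_chart_def)
    then have "closedin M (topspace M - chart_dom c)" "x \<in> topspace M - (topspace M - chart_dom c)"
      using x c by auto
    then obtain \<phi> where \<phi>: "continuous_map M (top_of_set {0..1}) \<phi>" "\<phi> x = (0::real)"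
      "\<phi> ` (topspace M - chart_dom c) \<subseteq> {1}"
      using creg unfolding completely_regular_space_def by meson
    have cont: "continuous_map M euclideanreal \<phi>"
      using \<phi>(1) by (simp add: continuous_map_in_subtopology)
    \<comment> \<open>Cutting off at 1/2 puts the closure of the support, and not only the support, inside the chart.\<close>
    define \<psi> where "\<psi> y = max 0 (1/2 - \<phi> y)" for y
    have "continuous_map M euclideanreal \<psi>"
      unfolding \<psi>_def by (intro continuous_map_real_max continuous_map_diff cont) auto
    moreover have "M closure_of {y \<in> topspace M. \<psi> y \<noteq> 0} \<subseteq> {y \<in> topspace M. \<phi> y \<in> {..1/2}}"
      by (intro closure_of_minimal closedin_continuous_map_preimage[OF cont]) (auto simp: \<psi>_def max_def)
    moreover have "{y \<in> topspace M. \<phi> y \<in> {..1/2}} \<subseteq> chart_dom c"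
      using \<phi>(3) by fastforce
    ultimately show ?thesis using c \<phi>(2)
      unfolding bump_at_def by (intro exI[of _ c] exI[of _ \<psi>]) (auto simp: \<psi>_def)
  qed
  then obtain c \<psi> where "\<And>x. x \<in> topspace M \<Longrightarrow> bump_at x (c x) (\<psi> x)" by metis
  then have c: "\<And>x. x \<in> topspace M \<Longrightarrow> c x \<in> A"
    and \<psi>: "\<And>x. x \<in> topspace M \<Longrightarrow> continuous_map M euclideanreal (\<psi> x)"
    and nonneg: "\<And>x y. x \<in> topspace M \<Longrightarrow> 0 \<le> \<psi> x y"
    and supp: "\<And>x. x \<in> topspace M \<Longrightarrow> M closure_of {y \<in> topspace M. \<psi> x y \<noteq> 0} \<subseteq> chart_dom (c x)"
    and pos: "\<And>x. x \<in> topspace M \<Longrightarrow> \<psi> x x > 0"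
    unfolding bump_at_def by blast+
  define W where "W x = {y \<in> topspace M. \<psi> x y \<in> {0<..}}" for x
  have "openin M (W x)" if "x \<in> topspace M" for x
    unfolding W_def by (rule openin_continuous_map_preimage[OF \<psi>[OF that]]) auto
  moreover have "topspace M \<subseteq> \<Union>(W ` topspace M)" using pos by (auto simp: W_def)
  ultimately obtain \<F> where "finite \<F>" "\<F> \<subseteq> W ` topspace M" "topspace M \<subseteq> \<Union>\<F>"
    using compact unfolding compact_space_alt by (metis (no_types, lifting) imageE)
  then obtain X where X: "finite X" "X \<subseteq> topspace M" "topspace M \<subseteq> \<Union>(W ` X)"
    by (metis finite_subset_image)
  define \<sigma> where "\<sigma> y = (\<Sum>x\<in>X. \<psi> x y)" for y
  have \<sigma>: "\<sigma> y > 0" if y: "y \<in> topspace M" for y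
  proof -
    obtain x where "x \<in> X" "\<psi> x y > 0" using X(3) y by (auto simp: W_def)
    then show ?thesis unfolding \<sigma>_def using X nonneg by (intro sum_pos2[of _ x]) auto
  qed
  define \<rho> where "\<rho> d y = (\<Sum>x\<in>{x\<in>X. c x = d}. \<psi> x y) / \<sigma> y" for d y
  have "partition_of_unity M A (c ` X) \<rho>"
    unfolding partition_of_unity_def
  proof (intro conjI ballI)
    show "finite (c ` X)" using X by simp
    show "c ` X \<subseteq> A" using X c by auto
    fix d assume "d \<in> c ` X"
    show "continuous_map M euclideanreal (\<rho> d)"
      unfolding \<rho>_def \<sigma>_def using X \<psi> \<sigma>
      by (intro continuous_map_real_divide continuous_map_sum) (auto simp: \<sigma>_def less_imp_neq[THEN not_sym] subset_iff)
    show "0 \<le> \<rho> d x" if "x \<in> topspace M" for x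
      unfolding \<rho>_def using X nonneg \<sigma>[OF that] by (intro divide_nonneg_pos sum_nonneg) auto
    have "{y \<in> topspace M. \<rho> d y \<noteq> 0} \<subseteq> (\<Union>x\<in>{x\<in>X. c x = d}. M closure_of {y \<in> topspace M. \<psi> x y \<noteq> 0})"
    proof
      fix y assume y: "y \<in> {y \<in> topspace M. \<rho> d y \<noteq> 0}"
      then obtain x where x: "x \<in> X" "c x = d" "\<psi> x y \<noteq> 0"
        unfolding \<rho>_def using sum.not_neutral_contains_not_neutral by (smt (verit) divide_eq_0_iff mem_Collect_eq)
      moreover have "y \<in> M closure_of {y \<in> topspace M. \<psi> x y \<noteq> 0}"
        using y x(3) by (intro subsetD[OF closure_of_subset]) auto
      ultimately show "y \<in> (\<Union>x\<in>{x\<in>X. c x = d}. M closure_of {y \<in> topspace M. \<psi> x y \<noteq> 0})" by blast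
    qed
    then have "M closure_of {y \<in> topspace M. \<rho> d y \<noteq> 0} \<subseteq>
        (\<Union>x\<in>{x\<in>X. c x = d}. M closure_of {y \<in> topspace M. \<psi> x y \<noteq> 0})"
      by (rule closure_of_minimal) (use X in \<open>auto intro!: closedin_Union\<close>)
    also have "\<dots> \<subseteq> chart_dom d" using supp X by blast
    finally show "M closure_of {x \<in> topspace M. \<rho> d x \<noteq> 0} \<subseteq> chart_dom d" .
  next
    fix y assume y: "y \<in> topspace M"
    have "(\<Sum>d\<in>c ` X. \<Sum>x\<in>{x\<in>X. c x = d}. \<psi> x y) = \<sigma> y"
      unfolding \<sigma>_def by (rule sum.group) (use X in auto)
    then show "(\<Sum>d\<in>c ` X. \<rho> d y) = 1"
      using \<sigma>[OF y] by (simp add: \<rho>_def flip: sum_divide_distrib)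
  qed
  then show ?thesis by blast
qed

section \<open>Integrals with a compactly supported weight\<close>

text \<open>In a chart the integrals over the manifold have the form \<open>\<integral>\<^sub>U w h\<close>, where the weight \<open>w\<close> is a
partition function times the volume density. Since \<open>w\<close> vanishes outside a compact subset of \<open>U\<close>,
the function \<open>h\<close> only has to be continuous on \<open>U\<close>.\<close>

locale compactly_supported_weight =
  fixes U K :: "'a::euclidean_space set" and w :: "'a \<Rightarrow> real"
  assumes U: "open U" and K: "compact K" "K \<subseteq> U"
    and w: "continuous_on U w" and support: "\<And>z. z \<in> U \<Longrightarrow> z \<notin> K \<Longrightarrow> w z = 0"
begin

lemma weighted_eq:
  fixes h :: "'a \<Rightarrow> real"
  shows "indicator U z *\<^sub>R (w z * h z) = indicator K z *\<^sub>R (w z * h z)"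
  using support K by (auto simp: indicator_def)

lemma set_integrable_weighted:
  fixes h :: "'a \<Rightarrow> real"
  assumes "continuous_on U h"
  shows "set_integrable lborel U (\<lambda>z. w z * h z)"
  unfolding set_integrable_def weighted_eq
  using K w assms by (intro borel_integrable_compact continuous_on_mult) (auto intro: continuous_on_subset)

lemma weighted_integral_pos:
  assumes nonneg: "\<And>z. z \<in> U \<Longrightarrow> w z \<ge> 0" and z: "z \<in> U" "w z > 0"
  shows "(LINT z:U|lborel. w z) > 0"
proof -
  have "isCont w z" using w U z by (simp add: continuous_on_eq_continuous_at)
  then have "eventually (\<lambda>y. w y > w z / 2) (nhds z)"
    using z by (intro order_tendstoD) (auto simp: continuous_at tendsto_at_iff_tendsto_nhds)
  then obtain e1 where e1: "e1 > 0" "\<And>y. dist y z < e1 \<Longrightarrow> w y > w z / 2"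
    by (auto simp: eventually_nhds_metric)
  obtain e2 where e2: "e2 > 0" "ball z e2 \<subseteq> U" using U z openE by blast
  let ?B = "ball z (min e1 e2)"
  have "integral\<^sup>L lborel (\<lambda>y. indicator ?B y *\<^sub>R (w z / 2)) \<le> integral\<^sup>L lborel (\<lambda>y. indicator U y *\<^sub>R w y)"
  proof (rule integral_mono)
    show "integrable lborel (\<lambda>y. indicator ?B y *\<^sub>R (w z / 2))"
      by (intro integrable_scaleR_left integrable_real_indicator emeasure_lborel_ball_finite) auto
    show "integrable lborel (\<lambda>y. indicator U y *\<^sub>R w y)"
      using set_integrable_weighted[of "\<lambda>_. 1"] by (simp add: set_integrable_def)
    show "indicator ?B y *\<^sub>R (w z / 2) \<le> indicator U y *\<^sub>R w y" for y
      using e1(2)[of y] e2(2) nonneg[of y] by (auto simp: indicator_def dist_commute subset_iff intro: less_imp_le)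
  qed
  moreover have "integral\<^sup>L lborel (\<lambda>y. indicator ?B y *\<^sub>R (w z / 2)) = measure lborel ?B * (w z / 2)"
    by simp
  moreover have "measure lborel ?B > 0" using e1(1) e2(1) content_ball_pos[of "min e1 e2" z] by simp
  then have "measure lborel ?B * (w z / 2) > 0" using z(2) by simp
  ultimately show ?thesis unfolding set_lebesgue_integral_def by linarith
qed

text \<open>Differentiation under the integral sign: the mean value theorem bounds the difference quotients by
\<open>B\<close> on \<open>K\<close>, and dominated convergence applies along every sequence tending to 0.\<close>

lemma has_real_derivative_weighted_integral:
  fixes H H' :: "real \<Rightarrow> 'a \<Rightarrow> real"
  assumes H: "\<And>t z. z \<in> U \<Longrightarrow> ((\<lambda>t. H t z) has_real_derivative H' t z) (at t)"
    and cont: "\<And>t. continuous_on U (H t)" "continuous_on U (H' 0)"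
    and bound: "\<And>t z. \<bar>t\<bar> \<le> 1 \<Longrightarrow> z \<in> K \<Longrightarrow> \<bar>H' t z\<bar> \<le> B"
  shows "((\<lambda>t. LINT z:U|lborel. w z * H t z) has_real_derivative (LINT z:U|lborel. w z * H' 0 z)) (at 0)"
proof -
  let ?F = "\<lambda>t. LINT z:U|lborel. w z * H t z"
  let ?S = "{-1<..<1::real}"
  have "((\<lambda>t. (?F t - ?F 0) / (t - 0)) \<longlongrightarrow> (LINT z:U|lborel. w z * H' 0 z)) (at 0 within ?S)"
    unfolding tendsto_at_iff_sequentially o_def
  proof (intro allI impI)
    fix X :: "nat \<Rightarrow> real" assume X: "\<forall>i. X i \<in> ?S - {0}" "X \<longlonglongrightarrow> 0"
    let ?q = "\<lambda>i z. (H (X i) z - H 0 z) / X i"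
    have q_cont: "continuous_on U (?q i)" for i
      using X(1) by (intro continuous_intros cont) auto
    have quot: "(?F (X i) - ?F 0) / (X i - 0) = integral\<^sup>L lborel (\<lambda>z. indicator U z *\<^sub>R (w z * ?q i z))" for i
    proof -
      have "?F (X i) - ?F 0 = (LINT z:U|lborel. w z * H (X i) z - w z * H 0 z)"
        by (intro set_integral_diff(2)[symmetric] set_integrable_weighted cont)
      then have "(?F (X i) - ?F 0) / X i = (LINT z:U|lborel. (w z * H (X i) z - w z * H 0 z) / X i)"
        by simp
      then show ?thesis by (simp add: set_lebesgue_integral_def right_diff_distrib)
    qed
    have "(\<lambda>i. integral\<^sup>L lborel (\<lambda>z. indicator U z *\<^sub>R (w z * ?q i z))) \<longlonglongrightarrow>
        integral\<^sup>L lborel (\<lambda>z. indicator U z *\<^sub>R (w z * H' 0 z))"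
    proof (rule integral_dominated_convergence)
      show "(\<lambda>z. indicator U z *\<^sub>R (w z * H' 0 z)) \<in> borel_measurable lborel"
        "(\<lambda>z. indicator U z *\<^sub>R (w z * ?q i z)) \<in> borel_measurable lborel" for i
        using set_integrable_weighted[OF cont(2)] set_integrable_weighted[OF q_cont[of i]]
        by (simp_all only: set_integrable_def borel_measurable_integrable)
      have "continuous_on K (\<lambda>z. \<bar>w z\<bar> * B)"
        using w K by (auto intro!: continuous_intros intro: continuous_on_subset)
      then show "integrable lborel (\<lambda>z. indicator K z *\<^sub>R (\<bar>w z\<bar> * B))"
        by (rule borel_integrable_compact[OF K(1)])
      show "AE z in lborel. (\<lambda>i. indicator U z *\<^sub>R (w z * ?q i z)) \<longlonglongrightarrow> indicator U z *\<^sub>R (w z * H' 0 z)"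
      proof (rule AE_I2)
        fix z
        have lim: "(\<lambda>i. ?q i z) \<longlonglongrightarrow> H' 0 z" if "z \<in> U"
        proof -
          have "((\<lambda>t. (H t z - H 0 z) / (t - 0)) \<longlongrightarrow> H' 0 z) (at 0)"
            using H[OF that, of 0] by (simp only: has_field_derivative_iff)
          then have "((\<lambda>t. (H t z - H 0 z) / (t - 0)) \<circ> X) \<longlonglongrightarrow> H' 0 z"
            using X unfolding tendsto_at_iff_sequentially by blast
          then show ?thesis by (simp add: o_def)
        qed
        show "(\<lambda>i. indicator U z *\<^sub>R (w z * ?q i z)) \<longlonglongrightarrow> indicator U z *\<^sub>R (w z * H' 0 z)"
        proof (cases "z \<in> U")
          case True
          show ?thesis by (intro tendsto_scaleR tendsto_mult tendsto_const lim True)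
        qed simp
      qed
      fix i
      show "AE z in lborel. norm (indicator U z *\<^sub>R (w z * ?q i z)) \<le> indicator K z *\<^sub>R (\<bar>w z\<bar> * B)"
      proof (rule AE_I2)
        fix z
        have q_bound: "\<bar>?q i z\<bar> \<le> B" if z: "z \<in> K"
        proof -
          have "norm (H (X i) z - H 0 z) \<le> B * norm (X i - 0)"
          proof (rule field_differentiable_bound[of ?S "\<lambda>t. H t z" "\<lambda>t. H' t z"])
            show "((\<lambda>t. H t z) has_field_derivative H' t z) (at t within ?S)" for t
              using H[of z t] z K by (auto intro: has_field_derivative_at_within)
            show "norm (H' t z) \<le> B" if "t \<in> ?S" for t
              using bound[of t z] z that by auto
          qed (use X(1) in auto)
          moreover have "\<bar>X i\<bar> > 0" using X(1) by auto
          ultimately show ?thesis by (simp add: abs_divide pos_divide_le_eq)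
        qed
        have "\<bar>w z\<bar> * \<bar>?q i z\<bar> \<le> \<bar>w z\<bar> * B" if "z \<in> K"
          using q_bound[OF that] by (rule mult_left_mono) simp
        then show "norm (indicator U z *\<^sub>R (w z * ?q i z)) \<le> indicator K z *\<^sub>R (\<bar>w z\<bar> * B)"
          unfolding weighted_eq[of z "?q i"] norm_scaleR real_norm_def abs_mult
          by (cases "z \<in> K") (simp_all add: abs_mult)
      qed
    qed
    then show "(\<lambda>i. (?F (X i) - ?F 0) / (X i - 0)) \<longlonglongrightarrow> (LINT z:U|lborel. w z * H' 0 z)"
      unfolding quot by (simp add: set_lebesgue_integral_def)
  qed
  then have "(?F has_real_derivative (LINT z:U|lborel. w z * H' 0 z)) (at 0 within ?S)"
    by (simp only: has_field_derivative_iff)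
  moreover have "at (0::real) within ?S = at 0" by (rule at_within_open) auto
  ultimately show ?thesis by simp
qed

end

section \<open>Integration over the manifold\<close>

lemma set_lebesgue_integral_cong_on:
  assumes "\<And>z. z \<in> S \<Longrightarrow> f z = (h z :: real)"
  shows "(LINT z:S|N. f z) = (LINT z:S|N. h z)"
  unfolding set_lebesgue_integral_def
  by (rule Bochner_Integration.integral_cong) (auto simp: indicator_def assms)

locale compact_hermitian_manifold = hermitian_manifold M A g
  for M :: "'a topology" and A :: "('a, 'n::finite) chart set" and g :: "('a, 'n) metric" +
  assumes compact: "compact_space M"
begin

text \<open>The partition of unity chosen in \<^const>\<open>integral_M\<close> does not involve the metric. The same one
therefore serves all conformal metrics, and the integrals of the variation can be differentiated
chart by chart.\<close>

definition charts :: "('a, 'n) chart set" where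
  "charts = fst (SOME (I, \<rho>). partition_of_unity M A I \<rho>)"

definition bump :: "('a, 'n) chart \<Rightarrow> 'a \<Rightarrow> real" where
  "bump = snd (SOME (I, \<rho>). partition_of_unity M A I \<rho>)"

lemma partition: "partition_of_unity M A charts bump"
proof -
  obtain I \<rho> where "partition_of_unity M A I \<rho>"
    using compact_manifold_partition_of_unity[OF manifold compact] by blast
  then have "(\<lambda>(I, \<rho>). partition_of_unity M A I \<rho>) (I, \<rho>)" by simp
  then have "(\<lambda>(I, \<rho>). partition_of_unity M A I \<rho>) (SOME (I, \<rho>). partition_of_unity M A I \<rho>)"
    by (rule someI[of "\<lambda>(I, \<rho>). partition_of_unity M A I \<rho>"])
  then show ?thesis unfolding charts_def bump_def split_beta .
qed

lemma charts_subset: "c \<in> charts \<Longrightarrow> c \<in> A" and finite_charts: "finite charts"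
  using partition by (auto simp: partition_of_unity_def)

definition weight :: "('a, 'n) chart \<Rightarrow> complex^'n \<Rightarrow> real" where
  "weight c z = bump c (chart_inv c z) * vol_density g c (chart_inv c z)"

lemma integral_M_conformal:
  "integral_M M A (conformal_metric u g) h =
    (\<Sum>c\<in>charts. LINT z:chart_image c|lborel.
      weight c z * (exp (real CARD('n) * u (chart_inv c z)) * h (chart_inv c z)))"
  by (simp add: integral_M_def charts_def bump_def weight_def split_beta vol_density_conformal mult_ac)

lemma integral_M_eq:
  "integral_M M A g h =
    (\<Sum>c\<in>charts. LINT z:chart_image c|lborel. weight c z * h (chart_inv c z))"
  by (simp add: integral_M_def charts_def bump_def weight_def split_beta mult_ac)

lemma weight_support:
  assumes c: "c \<in> charts"
  shows "\<exists>K. compactly_supported_weight (chart_image c) K (weight c)"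
proof -
  note cc = chart[OF charts_subset[OF c]]
  let ?T = "M closure_of {x \<in> topspace M. bump c x \<noteq> 0}"
  have T: "?T \<subseteq> chart_dom c" and cont: "continuous_map M euclideanreal (bump c)"
    using partition c by (auto simp: partition_of_unity_def)
  have "compactin M ?T" by (rule closedin_compact_space[OF compact closedin_closure_of])
  then have "compactin (subtopology M (chart_dom c)) ?T" using T by (simp add: compactin_subtopology)
  then have "compactin euclidean (chart_map c ` ?T)"
    by (rule image_compactin[OF _ continuous_map_chart_map[OF cc]])
  then have K: "compact (chart_map c ` ?T)" by simp
  have "compactly_supported_weight (chart_image c) (chart_map c ` ?T) (weight c)"
  proof
    show "open (chart_image c)" by (rule open_chart_image[OF cc])
    show "compact (chart_map c ` ?T)" by (rule K)
    show "chart_map c ` ?T \<subseteq> chart_image c" using T unfolding chart_image_def by blast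
    show "continuous_on (chart_image c) (weight c)"
      unfolding weight_def[abs_def]
      by (intro continuous_on_mult continuous_on_chart_inv[OF cc cont]
          continuous_on_vol_density[OF charts_subset[OF c]])
    fix z assume z: "z \<in> chart_image c" "z \<notin> chart_map c ` ?T"
    have "chart_inv c z \<in> topspace M"
      using chart_inv_in_dom[OF z(1)] chart_dom_topspace[OF cc] by blast
    moreover have "chart_inv c z \<notin> ?T"
    proof
      assume "chart_inv c z \<in> ?T"
      then have "chart_map c (chart_inv c z) \<in> chart_map c ` ?T" by (rule imageI)
      then show False using z(2) unfolding chart_map_inv[OF z(1)] by contradiction
    qed
    moreover have "{x \<in> topspace M. bump c x \<noteq> 0} \<subseteq> ?T" by (rule closure_of_subset) auto
    ultimately have "bump c (chart_inv c z) = 0" by blast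
    then show "weight c z = 0" by (simp add: weight_def)
  qed
  then show ?thesis by blast
qed

text \<open>On the manifold this is the same as continuity; integrals only need it in this form.\<close>

definition chartwise_continuous :: "('a \<Rightarrow> real) \<Rightarrow> bool" where
  "chartwise_continuous h \<longleftrightarrow> (\<forall>c\<in>A. continuous_on (chart_image c) (\<lambda>z. h (chart_inv c z)))"

lemma integral_M_add:
  assumes "chartwise_continuous h" "chartwise_continuous k"
  shows "integral_M M A g (\<lambda>x. h x + k x) = integral_M M A g h + integral_M M A g k"
proof -
  have "(LINT z:chart_image c|lborel. weight c z * (h (chart_inv c z) + k (chart_inv c z))) =
     (LINT z:chart_image c|lborel. weight c z * h (chart_inv c z)) +
     (LINT z:chart_image c|lborel. weight c z * k (chart_inv c z))" if c: "c \<in> charts" for c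
  proof -
    obtain K where "compactly_supported_weight (chart_image c) K (weight c)"
      using weight_support[OF c] by blast
    then interpret compactly_supported_weight "chart_image c" K "weight c" .
    show ?thesis unfolding distrib_left
      using assms charts_subset[OF c] unfolding chartwise_continuous_def
      by (intro set_integral_add set_integrable_weighted) auto
  qed
  then show ?thesis by (simp add: integral_M_eq sum.distrib)
qed

lemma integral_M_cmult: "integral_M M A g (\<lambda>x. a * h x) = a * integral_M M A g h"
  by (simp add: integral_M_eq sum_distrib_left mult.left_commute[of _ a])

lemma chart_inv_topspace: "c \<in> charts \<Longrightarrow> z \<in> chart_image c \<Longrightarrow> chart_inv c z \<in> topspace M"
  using chart_inv_in_dom chart_dom_topspace[OF chart[OF charts_subset]] by blast

lemma integral_M_cong:
  assumes "\<And>x. x \<in> topspace M \<Longrightarrow> h x = k x"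
  shows "integral_M M A g h = integral_M M A g k"
  unfolding integral_M_eq
  by (intro sum.cong refl set_lebesgue_integral_cong_on) (simp add: assms chart_inv_topspace)

lemma integral_M_empty:
  assumes "topspace M = {}"
  shows "integral_M M A g' h = 0"
proof -
  have "chart_image c = {}" if "c \<in> charts" for c
    using that chart_inv_topspace assms by blast
  then show ?thesis
    by (simp add: integral_M_def set_lebesgue_integral_def flip: charts_def bump_def add: split_beta)
qed

text \<open>At any point some partition function is positive, and so is the volume density; a continuous
nonnegative integrand that is positive somewhere has positive integral.\<close>

lemma total_volume_pos:
  assumes "topspace M \<noteq> {}"
  shows "integral_M M A g (\<lambda>_. 1) > 0"
proof -
  obtain x where x: "x \<in> topspace M" using assms by blast
  have nonneg: "weight c z \<ge> 0" if "c \<in> charts" "z \<in> chart_image c" for c z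
  proof -
    have "bump c (chart_inv c z) \<ge> 0"
      using partition chart_inv_topspace[OF that] that(1) by (simp add: partition_of_unity_def)
    moreover have "vol_density g c (chart_inv c z) > 0"
      by (rule vol_density_pos[OF charts_subset chart_inv_in_dom, OF that])
    ultimately show ?thesis by (simp add: weight_def)
  qed
  have int_nonneg: "(LINT z:chart_image c|lborel. weight c z) \<ge> 0" if "c \<in> charts" for c
    unfolding set_lebesgue_integral_def
    by (rule integral_nonneg_AE) (use nonneg[OF that] in \<open>auto simp: indicator_def\<close>)
  have "(\<Sum>c\<in>charts. bump c x) = 1" using partition x by (simp add: partition_of_unity_def)
  then obtain c where c: "c \<in> charts" "bump c x \<noteq> 0"
    by (metis sum.neutral zero_neq_one)
  then have bump: "bump c x > 0" using partition x by (force simp: partition_of_unity_def)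
  have "x \<in> M closure_of {x \<in> topspace M. bump c x \<noteq> 0}"
    using x c(2) by (intro subsetD[OF closure_of_subset]) auto
  then have dom: "x \<in> chart_dom c" using partition c(1) by (auto simp: partition_of_unity_def)
  have inv: "chart_inv c (chart_map c x) = x" by (rule chart_inv_map[OF chart[OF charts_subset[OF c(1)]] dom])
  obtain K where "compactly_supported_weight (chart_image c) K (weight c)"
    using weight_support[OF c(1)] by blast
  then interpret compactly_supported_weight "chart_image c" K "weight c" .
  have "weight c (chart_map c x) > 0"
    using bump vol_density_pos[OF charts_subset[OF c(1)] dom] by (simp add: weight_def inv)
  then have "(LINT z:chart_image c|lborel. weight c z) > 0"
    using weighted_integral_pos[OF nonneg[OF c(1)] chart_map_in_image[OF dom]] by blast
  then show ?thesis
    unfolding integral_M_eq using int_nonneg finite_charts c(1) by (auto intro!: sum_pos2[of _ c])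
qed

text \<open>Joint continuity of the derivative bounds it on the compact product of \<open>{-1..1}\<close> with the support of
a weight.\<close>

lemma has_real_derivative_integral_M:
  assumes H: "\<And>t x. x \<in> topspace M \<Longrightarrow> ((\<lambda>t. H t x) has_real_derivative H' t x) (at t)"
    and cont: "\<And>t. chartwise_continuous (H t)"
    and cont': "\<And>c. c \<in> A \<Longrightarrow>
       continuous_on (UNIV \<times> chart_image c) (\<lambda>q. H' (fst q) (chart_inv c (snd q)))"
  shows "((\<lambda>t. integral_M M A g (H t)) has_real_derivative integral_M M A g (H' 0)) (at 0)"
  unfolding integral_M_eq
proof (rule DERIV_sum)
  fix c assume c: "c \<in> charts"
  obtain K where "compactly_supported_weight (chart_image c) K (weight c)"
    using weight_support[OF c] by blast
  then interpret compactly_supported_weight "chart_image c" K "weight c" .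
  note joint = cont'[OF charts_subset[OF c]]
  have "continuous_on ({-1..1} \<times> K) (\<lambda>q. H' (fst q) (chart_inv c (snd q)))"
    by (rule continuous_on_subset[OF joint]) (use K in auto)
  then have "bounded ((\<lambda>q. H' (fst q) (chart_inv c (snd q))) ` ({-1..1} \<times> K))"
    using K by (intro compact_imp_bounded compact_continuous_image compact_Times compact_Icc)
  then obtain B where B: "\<And>q. q \<in> {-1..1} \<times> K \<Longrightarrow> \<bar>H' (fst q) (chart_inv c (snd q))\<bar> \<le> B"
    unfolding bounded_iff real_norm_def by blast
  have B: "\<bar>H' t (chart_inv c z)\<bar> \<le> B" if "\<bar>t\<bar> \<le> 1" "z \<in> K" for t z
    using B[of "(t, z)"] that by (auto simp: abs_le_iff)
  have "continuous_on (chart_image c) (\<lambda>z. (0::real, z))" by (intro continuous_intros)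
  from continuous_on_compose2[OF joint this]
  have H'0: "continuous_on (chart_image c) (\<lambda>z. H' 0 (chart_inv c z))" by auto
  show "((\<lambda>t. LINT z:chart_image c|lborel. weight c z * H t (chart_inv c z)) has_real_derivative
      (LINT z:chart_image c|lborel. weight c z * H' 0 (chart_inv c z))) (at 0)"
  proof (rule has_real_derivative_weighted_integral[of "\<lambda>t z. H t (chart_inv c z)" "\<lambda>t z. H' t (chart_inv c z)"])
    show "((\<lambda>t. H t (chart_inv c z)) has_real_derivative H' t (chart_inv c z)) (at t)"
      if "z \<in> chart_image c" for t z
      using H chart_inv_topspace[OF c that] by blast
  qed (use cont charts_subset[OF c] B H'0 in \<open>auto simp: chartwise_continuous_def\<close>)
qed

end

section \<open>The first variation\<close>

text \<open>The function is continuously differentiable even at 0, where \<open>\<bar>h\<bar> powr p / \<bar>h\<bar> = \<bar>h\<bar> powr (p - 1)\<close> tends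
to 0 because \<open>p > 1\<close>. This makes the functional differentiable at metrics whose curvature has zeros.\<close>

lemma has_real_derivative_abs_powr:
  fixes x p :: real
  assumes p: "p > 1"
  shows "((\<lambda>x. \<bar>x\<bar> powr p) has_real_derivative p * (x * \<bar>x\<bar> powr (p - 2))) (at x)"
proof (cases x "0 :: real" rule: linorder_cases)
  case greater
  have "((\<lambda>x. x powr p) has_real_derivative p * x powr (p - 1)) (at x)"
    using greater by (rule has_real_derivative_powr)
  then have "((\<lambda>x. \<bar>x\<bar> powr p) has_real_derivative p * x powr (p - 1)) (at x)"
    by (rule has_field_derivative_transform_within_open[of _ _ _ "{0<..}"]) (use greater in auto)
  moreover have "x * x powr (p - 2) = x powr (p - 1)"
    using greater powr_mult_base[of x "p - 2"] by simp
  ultimately show ?thesis using greater by simp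
next
  case less
  have "((\<lambda>x. (- x) powr p) has_real_derivative (p * (- x) powr (p - 1)) * (- 1)) (at x)"
    using less by (intro DERIV_chain2[of "\<lambda>x. x powr p" _ uminus] has_real_derivative_powr)
      (auto intro!: derivative_eq_intros)
  then have "((\<lambda>x. \<bar>x\<bar> powr p) has_real_derivative (p * (- x) powr (p - 1)) * (- 1)) (at x)"
    by (rule has_field_derivative_transform_within_open[of _ _ _ "{..<0}"]) (use less in auto)
  moreover have "(- x) powr (p - 1) = (- x) * \<bar>x\<bar> powr (p - 2)"
    using less powr_mult_base[of "- x" "p - 2"] by simp
  ultimately show ?thesis by simp
next
  case equal
  have "((\<lambda>h. \<bar>h\<bar> powr (p - 1)) \<longlongrightarrow> 0) (at (0::real))"
    using p by (auto intro!: tendsto_eq_intros simp: eventually_at_filter)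
  then have "((\<lambda>h. \<bar>h\<bar> powr p / h) \<longlongrightarrow> 0) (at (0::real))"
  proof (rule Lim_null_comparison[rotated])
    have "\<bar>h\<bar> powr p = \<bar>h\<bar> * \<bar>h\<bar> powr (p - 1)" for h :: real
      using powr_mult_base[of "\<bar>h\<bar>" "p - 1"] by simp
    then show "eventually (\<lambda>h. norm (\<bar>h\<bar> powr p / h) \<le> \<bar>h\<bar> powr (p - 1)) (at (0::real))"
      by (auto simp: eventually_at_filter abs_divide)
  qed
  then show ?thesis using equal p by (simp add: has_field_derivative_iff)
qed

lemma continuous_on_abs_powr:
  fixes h :: "'a::topological_space \<Rightarrow> real"
  assumes p: "p > 1" and h: "continuous_on S h"
  shows "continuous_on S (\<lambda>x. \<bar>h x\<bar> powr p)"
proof -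
  have "continuous_on UNIV (\<lambda>x::real. \<bar>x\<bar> powr p)"
    by (rule DERIV_continuous_on[OF has_field_derivative_at_within[OF has_real_derivative_abs_powr[OF p]]])
  then show ?thesis by (rule continuous_on_compose2[OF _ h]) simp
qed

lemma continuous_on_signed_powr:
  fixes h :: "'a::topological_space \<Rightarrow> real"
  assumes p: "p > 1" and h: "continuous_on S h"
  shows "continuous_on S (\<lambda>x. h x * \<bar>h x\<bar> powr (p - 2))"
proof -
  have "x * \<bar>x\<bar> powr (p - 2) = max x 0 powr (p - 1) - max (- x) 0 powr (p - 1)" for x :: real
    using powr_mult_base[of "\<bar>x\<bar>" "p - 2"] by (auto simp: max_def)
  moreover have "continuous_on UNIV (\<lambda>x::real. max x 0 powr (p - 1) - max (- x) 0 powr (p - 1))"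
    using p by (intro continuous_intros continuous_on_powr') auto
  ultimately have "continuous_on UNIV (\<lambda>x::real. x * \<bar>x\<bar> powr (p - 2))" by simp
  then show ?thesis by (rule continuous_on_compose2[OF _ h]) simp
qed

context compact_hermitian_manifold
begin

abbreviation scal :: "'a \<Rightarrow> real" where "scal \<equiv> chern_scalar A g"
abbreviation lap :: "('a \<Rightarrow> real) \<Rightarrow> 'a \<Rightarrow> real" where "lap \<equiv> complex_laplacian A g"
abbreviation integ :: "('a \<Rightarrow> real) \<Rightarrow> real" where "integ \<equiv> integral_M M A g"

text \<open>The factors \<open>e\<^bsup>-ptf\<^esup>\<close> of the curvature and \<open>e\<^bsup>ntf\<^esup>\<close> of the volume form combine, and the functional is
expressed by integrals against the fixed metric \<open>g\<close>.\<close>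

lemma calabi_functional_conformal:
  assumes f: "smooth_function A f"
  shows "calabi_functional M A p (conformal_metric (\<lambda>x. t * f x) g) =
    integ (\<lambda>x. exp ((real CARD('n) - p) * t * f x) * \<bar>scal x - real CARD('n) * t * lap f x\<bar> powr p) *
    integ (\<lambda>x. exp (real CARD('n) * t * f x)) powr (- ((real CARD('n) - p) / real CARD('n)))"
proof -
  let ?g = "conformal_metric (\<lambda>x. t * f x) g"
  have conf: "integral_M M A ?g h = integ (\<lambda>x. exp (real CARD('n) * (t * f x)) * h x)" for h
    unfolding integral_M_conformal integral_M_eq ..
  have "exp (real CARD('n) * (t * f x)) * \<bar>chern_scalar A ?g x\<bar> powr p =
      exp ((real CARD('n) - p) * t * f x) * \<bar>scal x - real CARD('n) * t * lap f x\<bar> powr p" if x: "x \<in> topspace M" for x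
  proof -
    have "chern_scalar A ?g x = exp (- (t * f x)) * (scal x - real CARD('n) * t * lap f x)"
      by (simp add: chern_scalar_conformal[OF smooth_function_scale[OF f] x] complex_laplacian_scale[OF f x])
    then have "\<bar>chern_scalar A ?g x\<bar> powr p = exp (- (t * f x)) powr p * \<bar>scal x - real CARD('n) * t * lap f x\<bar> powr p"
      by (simp add: abs_mult powr_mult)
    also have "exp (- (t * f x)) powr p = exp (- (p * t * f x))" by (simp add: powr_def)
    finally show ?thesis by (simp add: algebra_simps flip: exp_add)
  qed
  then show ?thesis
    unfolding calabi_functional_def conf
    by (simp add: integral_M_cong[of "\<lambda>x. exp (real CARD('n) * (t * f x)) * \<bar>chern_scalar A ?g x\<bar> powr p"] mult.assoc)
qed

lemma has_real_derivative_curvature_integral: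
  assumes p: "p > 1" and f: "smooth_function A f"
  shows "((\<lambda>t. integ (\<lambda>x. exp ((real CARD('n) - p) * t * f x) * \<bar>scal x - real CARD('n) * t * lap f x\<bar> powr p)) has_real_derivative
    (real CARD('n) - p) * integ (\<lambda>x. \<bar>scal x\<bar> powr p * f x) -
    real CARD('n) * p * integ (\<lambda>x. scal x * \<bar>scal x\<bar> powr (p - 2) * lap f x)) (at 0)"
proof -
  define \<kappa> :: "real \<Rightarrow> real" where "\<kappa> a = a * \<bar>a\<bar> powr (p - 2)" for a
  let ?a = "\<lambda>t x. scal x - real CARD('n) * t * lap f x"
  let ?H = "\<lambda>t x. exp ((real CARD('n) - p) * t * f x) * \<bar>?a t x\<bar> powr p"
  let ?H' = "\<lambda>t x. (real CARD('n) - p) * f x * exp ((real CARD('n) - p) * t * f x) * \<bar>?a t x\<bar> powr p +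
    p * \<kappa> (?a t x) * (- real CARD('n) * lap f x) * exp ((real CARD('n) - p) * t * f x)"
  note cont = continuous_on_chern_scalar continuous_on_complex_laplacian[OF _ f]
    continuous_on_smooth_function[OF _ f]
  note powr = continuous_on_abs_powr[OF p] and signed = continuous_on_signed_powr[OF p, folded \<kappa>_def]
  have "((\<lambda>t. integ (?H t)) has_real_derivative integ (?H' 0)) (at 0)"
  proof (rule has_real_derivative_integral_M)
    fix t x
    have a: "((\<lambda>t. \<bar>?a t x\<bar> powr p) has_real_derivative p * \<kappa> (?a t x) * (- real CARD('n) * lap f x)) (at t)"
      unfolding \<kappa>_def
      by (rule DERIV_chain2[OF has_real_derivative_abs_powr[OF p]]) (auto intro!: derivative_eq_intros)
    have e: "((\<lambda>t. exp ((real CARD('n) - p) * t * f x)) has_real_derivative (real CARD('n) - p) * f x * exp ((real CARD('n) - p) * t * f x)) (at t)"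
      by (auto intro!: derivative_eq_intros)
    show "((\<lambda>t. ?H t x) has_real_derivative ?H' t x) (at t)"
      by (rule DERIV_mult[OF e a])
  next
    show "chartwise_continuous (?H t)" for t
      unfolding chartwise_continuous_def by (intro ballI continuous_on_mult powr continuous_intros cont)
  next
    fix c assume c: "c \<in> A"
    have snd: "continuous_on (UNIV \<times> chart_image c) (\<lambda>q. h (chart_inv c (snd q)))"
      if "continuous_on (chart_image c) (\<lambda>z. h (chart_inv c z))" for h :: "'a \<Rightarrow> real"
      by (rule continuous_on_compose2[OF that]) (auto intro!: continuous_intros)
    note cont' = cont[OF c, THEN snd]
    have fst: "continuous_on (UNIV \<times> chart_image c) (\<lambda>q. fst q)" by (rule continuous_on_fst) (rule continuous_on_id)
    have a: "continuous_on (UNIV \<times> chart_image c) (\<lambda>q. ?a (fst q) (chart_inv c (snd q)))"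
      by (intro continuous_on_diff continuous_on_mult continuous_on_const cont' fst)
    show "continuous_on (UNIV \<times> chart_image c) (\<lambda>q. ?H' (fst q) (chart_inv c (snd q)))"
      by (intro continuous_on_add continuous_on_mult continuous_on_exp continuous_on_const cont' fst
          powr[OF a] signed[OF a])
  qed
  moreover have "integ (?H' 0) = (real CARD('n) - p) * integ (\<lambda>x. \<bar>scal x\<bar> powr p * f x) - real CARD('n) * p * integ (\<lambda>x. \<kappa> (scal x) * lap f x)"
  proof -
    have "integ (?H' 0) = integ (\<lambda>x. (real CARD('n) - p) * (\<bar>scal x\<bar> powr p * f x) + - (real CARD('n) * p) * (\<kappa> (scal x) * lap f x))"
      by (simp add: algebra_simps)
    also have "\<dots> = integ (\<lambda>x. (real CARD('n) - p) * (\<bar>scal x\<bar> powr p * f x)) + integ (\<lambda>x. - (real CARD('n) * p) * (\<kappa> (scal x) * lap f x))"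
      by (rule integral_M_add; unfold chartwise_continuous_def)
        (intro ballI continuous_on_mult continuous_on_const powr signed cont; assumption)+
    finally show ?thesis unfolding integral_M_cmult by simp
  qed
  ultimately show ?thesis by (simp add: \<kappa>_def)
qed

lemma has_real_derivative_volume:
  assumes f: "smooth_function A f"
  shows "((\<lambda>t. integ (\<lambda>x. exp (real CARD('n) * t * f x))) has_real_derivative real CARD('n) * integ f) (at 0)"
proof -
  have "((\<lambda>t. integ (\<lambda>x. exp (real CARD('n) * t * f x))) has_real_derivative
      integ (\<lambda>x. real CARD('n) * f x * exp (real CARD('n) * 0 * f x))) (at 0)"
  proof (rule has_real_derivative_integral_M[where H' = "\<lambda>t x. real CARD('n) * f x * exp (real CARD('n) * t * f x)"])
    show "((\<lambda>t. exp (real CARD('n) * t * f x)) has_real_derivative real CARD('n) * f x * exp (real CARD('n) * t * f x)) (at t)" for t x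
      by (auto intro!: derivative_eq_intros)
    show "chartwise_continuous (\<lambda>x. exp (real CARD('n) * t * f x))" for t
      unfolding chartwise_continuous_def by (auto intro!: continuous_intros continuous_on_smooth_function[OF _ f])
    fix c assume c: "c \<in> A"
    have "continuous_on (UNIV \<times> chart_image c) (\<lambda>q. f (chart_inv c (snd q)))"
      by (rule continuous_on_compose2[OF continuous_on_smooth_function[OF c f]]) (auto intro!: continuous_intros)
    then show "continuous_on (UNIV \<times> chart_image c)
        (\<lambda>q. real CARD('n) * f (chart_inv c (snd q)) * exp (real CARD('n) * fst q * f (chart_inv c (snd q))))"
      by (intro continuous_intros)
  qed
  then show ?thesis by (simp add: integral_M_cmult)
qed

text \<open>Leibniz rule for the two factors of the functional; since \<open>- (n - p) / n\<close> is the exponent of the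
volume and \<open>n\<close> the factor in its derivative, both terms without the Laplacian carry the
factor \<open>n - p\<close>.\<close>

lemma first_variation:
  assumes p: "p > 1" and f: "smooth_function A f" and M: "topspace M \<noteq> {}"
  shows "((\<lambda>t. calabi_functional M A p (conformal_metric (\<lambda>x. t * f x) g)) has_real_derivative
    integ (\<lambda>_. 1) powr (- ((real CARD('n) - p) / real CARD('n))) *
    ((real CARD('n) - p) * (integ (\<lambda>x. \<bar>scal x\<bar> powr p * f x) - integ (\<lambda>x. \<bar>scal x\<bar> powr p) / integ (\<lambda>_. 1) * integ f)
     - real CARD('n) * p * integ (\<lambda>x. scal x * \<bar>scal x\<bar> powr (p - 2) * lap f x))) (at 0)"
proof -
  define \<alpha> where "\<alpha> = (real CARD('n) - p) / real CARD('n)"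
  have \<alpha>: "\<alpha> * real CARD('n) = real CARD('n) - p" by (simp add: \<alpha>_def)
  let ?V = "\<lambda>t. integ (\<lambda>x. exp (real CARD('n) * t * f x))"
  have V0: "?V 0 = integ (\<lambda>_. 1)" by simp
  define V where "V = integ (\<lambda>_. 1)"
  have V: "V > 0" unfolding V_def by (rule total_volume_pos[OF M])
  have "((\<lambda>t. ?V t powr (- \<alpha>)) has_real_derivative (- \<alpha> * V powr (- \<alpha> - 1)) * (real CARD('n) * integ f)) (at 0)"
  proof (rule DERIV_chain2[of "\<lambda>v. v powr (- \<alpha>)"])
    show "((\<lambda>v. v powr (- \<alpha>)) has_real_derivative - \<alpha> * V powr (- \<alpha> - 1)) (at (?V 0))"
      using has_real_derivative_powr[OF V, of "- \<alpha>"] by (simp only: V0 V_def)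
  qed (rule has_real_derivative_volume[OF f])
  note D = DERIV_mult[OF has_real_derivative_curvature_integral[OF p f] this]
  define S where "S = integ (\<lambda>x. \<bar>scal x\<bar> powr p)"
  have S0: "integ (\<lambda>x. exp ((real CARD('n) - p) * 0 * f x) * \<bar>scal x - real CARD('n) * 0 * lap f x\<bar> powr p) = S"
    by (simp add: S_def)
  have "V powr (- \<alpha> - 1) = V powr (- \<alpha>) / V" using V by (simp add: powr_diff)
  then have dV: "(- \<alpha> * V powr (- \<alpha> - 1)) * (real CARD('n) * integ f) = - (real CARD('n) - p) * V powr (- \<alpha>) / V * integ f"
    by (simp add: mult_ac flip: \<alpha>)
  have collect: "(a * P - b * Q) * W + (- a * W / V * F) * S = W * (a * (P - S / V * F) - b * Q)"
    for a b P Q W F :: real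
    by (simp add: algebra_simps)
  show ?thesis
    unfolding calabi_functional_conformal[OF f] \<alpha>_def[symmetric]
    by (rule DERIV_cong[OF D]) (simp only: dV S0 V0 V_def[symmetric] S_def[symmetric] collect)
qed

lemma p_conformal_extremal_iff:
  assumes p: "p > 1"
  shows "p_conformal_extremal M A p g \<longleftrightarrow>
    adjoint_laplacian_eq M A g (\<lambda>x. scal x * \<bar>scal x\<bar> powr (p - 2))
      (\<lambda>x. (real CARD('n) - p) / (real CARD('n) * p) *
        (\<bar>scal x\<bar> powr p - 1 / integ (\<lambda>y. 1) * integ (\<lambda>y. \<bar>scal y\<bar> powr p)))"
proof (cases "topspace M = {}")
  \<comment> \<open>On the empty manifold all integrals are 0, and both sides hold.\<close>
  case True
  then show ?thesis
    unfolding p_conformal_extremal_def adjoint_laplacian_eq_def calabi_functional_def integral_M_empty[OF True]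
    by simp
next
  case False
  define V S where "V = integ (\<lambda>y. 1)" and "S = integ (\<lambda>y. \<bar>scal y\<bar> powr p)"
  have V: "V > 0" unfolding V_def by (rule total_volume_pos[OF False])
  have "((\<lambda>t. calabi_functional M A p (conformal_metric (\<lambda>x. t * f x) g)) has_real_derivative 0) (at 0) \<longleftrightarrow>
      integ (\<lambda>x. scal x * \<bar>scal x\<bar> powr (p - 2) * lap f x) =
      integ (\<lambda>x. (real CARD('n) - p) / (real CARD('n) * p) * (\<bar>scal x\<bar> powr p - 1 / V * S) * f x)"
    if f: "smooth_function A f" for f
  proof -
    let ?P = "integ (\<lambda>x. \<bar>scal x\<bar> powr p * f x)"
    let ?Q = "integ (\<lambda>x. scal x * \<bar>scal x\<bar> powr (p - 2) * lap f x)"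
    have "integ (\<lambda>x. (real CARD('n) - p) / (real CARD('n) * p) * (\<bar>scal x\<bar> powr p - 1 / V * S) * f x) =
        (real CARD('n) - p) / (real CARD('n) * p) * integ (\<lambda>x. \<bar>scal x\<bar> powr p * f x + - (S / V) * f x)"
    proof -
      have "a * (b - 1 / V * S) * y = a * (b * y + - (S / V) * y)" for a b y :: real
        by (simp add: algebra_simps)
      then show ?thesis by (simp only: flip: integral_M_cmult)
    qed
    also have "integ (\<lambda>x. \<bar>scal x\<bar> powr p * f x + - (S / V) * f x) = ?P + integ (\<lambda>x. - (S / V) * f x)"
      by (rule integral_M_add)
        (unfold chartwise_continuous_def, (intro ballI continuous_on_mult continuous_on_const
          continuous_on_abs_powr[OF p] continuous_on_chern_scalar continuous_on_smooth_function[OF _ f]; assumption)+)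
    also have "integ (\<lambda>x. - (S / V) * f x) = - (S / V) * integ f" by (rule integral_M_cmult)
    finally have rhs: "integ (\<lambda>x. (real CARD('n) - p) / (real CARD('n) * p) * (\<bar>scal x\<bar> powr p - 1 / V * S) * f x) =
        (real CARD('n) - p) / (real CARD('n) * p) * (?P - S / V * integ f)" by simp
    let ?D = "V powr (- ((real CARD('n) - p) / real CARD('n))) * ((real CARD('n) - p) * (?P - S / V * integ f) - real CARD('n) * p * ?Q)"
    have D: "((\<lambda>t. calabi_functional M A p (conformal_metric (\<lambda>x. t * f x) g)) has_real_derivative ?D) (at 0)"
      using first_variation[OF p f False] by (simp only: V_def S_def)
    have "((\<lambda>t. calabi_functional M A p (conformal_metric (\<lambda>x. t * f x) g)) has_real_derivative 0) (at 0) \<longleftrightarrow> ?D = 0"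
      by (rule iffI, erule DERIV_unique[OF D], rule DERIV_cong[OF D])
    also have "\<dots> \<longleftrightarrow> (real CARD('n) - p) * (?P - S / V * integ f) = real CARD('n) * p * ?Q" using V by simp
    also have "\<dots> \<longleftrightarrow> ?Q = (real CARD('n) - p) / (real CARD('n) * p) * (?P - S / V * integ f)"
    proof -
      have "real CARD('n) * p \<noteq> 0" using p by simp
      then show ?thesis by (auto simp: field_simps)
    qed
    finally show ?thesis unfolding rhs .
  qed
  then show ?thesis
    unfolding p_conformal_extremal_def adjoint_laplacian_eq_def V_def S_def by blast
qed

end

theorem theorem1p1:
  fixes M :: "'a topology" and A :: "('a, 'n::finite) chart set"
    and g :: "('a, 'n) metric" and p :: real
  assumes "complex_manifold M A" and "compact_space M" and "hermitian_metric A g"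
    and "CARD('n) \<ge> 2" and "p > 1"
  shows "p_conformal_extremal M A p g \<longleftrightarrow>
    adjoint_laplacian_eq M A g
      (\<lambda>x. chern_scalar A g x * \<bar>chern_scalar A g x\<bar> powr (p - 2))
      (\<lambda>x. (real CARD('n) - p) / (real CARD('n) * p) *
        (\<bar>chern_scalar A g x\<bar> powr p -
          1 / integral_M M A g (\<lambda>y. 1) *
          integral_M M A g (\<lambda>y. \<bar>chern_scalar A g y\<bar> powr p)))"
proof -
  interpret compact_hermitian_manifold M A g
    using assms by unfold_locales
  show ?thesis by (rule p_conformal_extremal_iff[OF \<open>p > 1\<close>])
qed

end
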